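(* Let $m,n$ be non-zero integers. The flat rank of $G_{m,n}$ is $1$ if $|m|\neq|n|$, and $0$ if $|m|=|n|$.
   Context: For non-zero integers $m,n$, $\mathrm{BS}(m,n)=\langle a,t\mid ta^mt^{-1}=a^n\rangle$. Let $\pi:\mathrm{BS}(m,n)\to \mathrm{Sym}(\mathrm{BS}(m,n)/\langle a\rangle)$ be the action by left multiplication on left cosets of $\langle a\rangle$. $\mathrm{Sym}(\mathrm{BS}(m,n)/\langle a\rangle)$ has the topology of pointwise convergence, with basis the sets $\mathcal N(x,F)=\{y\mid y(c)=x(c)\ \forall c\in F\}$, $F$ a finite set of cosets. $G_{m,n}$ is the closure of the image of $\pi$ with the subspace topology; it is a totally disconnected locally compact group. (If $|m|=|n|$ then $\ker\pi=\langle a^m\rangle$ and $G_{m,n}\cong\mathrm{BS}(m,n)/\langle a^m\rangle$ is discrete.) For a totally disconnected locally compact group $G$ and $x\in G$, the scale of $x$ is $s(x)=\min\{[V:V\cap x^{-1}Vx]\mid V\text{ a compact open subgroup of }G\}$, and a compact open subgroup $V$ attaining this minimum is called minimizing for $x$. A subgroup $P\le G$ is flat if some compact open subgroup $V$ of $G$ is minimizing for every $x\in P$. For a flat subgroup $P$, the set $P_1=\{x\in P\mid s(x)=s(x^{-1})=1\}$ is a normal subgroup of $P$ and, by a theorem of Willis, $P/P_1$ is free abelian of some rank in $\mathbb{N}\cup\{\infty\}$; this rank is the flat rank of $P$. The flat rank of $G$ is the supremum of the flat ranks of its flat subgroups. *)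

theory Defs
  imports
    "HOL-Analysis.Abstract_Topology"
    "HOL-Algebra.Bij"
    "HOL-Algebra.Left_Coset"
    "HOL-Algebra.Generated_Groups"
    "HOL-Algebra.Free_Abelian_Groups"
    "HOL-Library.Extended_Nat"
begin

section \<open>Group presentations and Baumslag--Solitar groups\<close>

text \<open>The letter \<open>(x, True)\<close> stands for the generator \<open>x\<close>, and \<open>(x, False)\<close> for its formal inverse.\<close>

type_synonym 'g word = "('g \<times> bool) list"

text \<open>A set \<open>R\<close> of pairs of words encodes the defining relations \<open>u = v\<close> for \<open>(u, v) \<in> R\<close>;
  \<open>word_eq R\<close> is the least congruence on words that contains \<open>R\<close> and makes formal inverses
  inverse.\<close>

inductive word_eq :: "('g word \<times> 'g word) set \<Rightarrow> 'g word \<Rightarrow> 'g word \<Rightarrow> bool"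
  for R :: "('g word \<times> 'g word) set" where
  refl: "word_eq R u u"
| sym: "word_eq R u v \<Longrightarrow> word_eq R v u"
| trans: "word_eq R u v \<Longrightarrow> word_eq R v w \<Longrightarrow> word_eq R u w"
| append: "word_eq R u u' \<Longrightarrow> word_eq R v v' \<Longrightarrow> word_eq R (u @ v) (u' @ v')"
| cancel: "word_eq R [(x, b), (x, \<not> b)] []"
| relation: "(u, v) \<in> R \<Longrightarrow> word_eq R u v"

definition word_class :: "('g word \<times> 'g word) set \<Rightarrow> 'g word \<Rightarrow> 'g word set" where
  "word_class R u = {v. word_eq R u v}"

text \<open>All elements of the type \<open>'g\<close> serve as generators.\<close>

definition presented_group :: "('g word \<times> 'g word) set \<Rightarrow> 'g word set monoid" where
  "presented_group R =
    \<lparr>carrier = range (word_class R),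
     mult = (\<lambda>X Y. {w. \<exists>u\<in>X. \<exists>v\<in>Y. word_eq R (u @ v) w}),
     one = word_class R []\<rparr>"

datatype bs_gen = GenA | GenT

definition gen_power :: "'g \<Rightarrow> int \<Rightarrow> 'g word" where
  "gen_power x k = replicate (nat \<bar>k\<bar>) (x, 0 \<le> k)"

definition BS_rels :: "int \<Rightarrow> int \<Rightarrow> (bs_gen word \<times> bs_gen word) set" where
  "BS_rels m n =
    {(gen_power GenT 1 @ gen_power GenA m @ gen_power GenT (-1), gen_power GenA n)}"

definition BS :: "int \<Rightarrow> int \<Rightarrow> bs_gen word set monoid" where
  "BS m n = presented_group (BS_rels m n)"

definition BS_a :: "int \<Rightarrow> int \<Rightarrow> bs_gen word set" where
  "BS_a m n = word_class (BS_rels m n) [(GenA, True)]"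


section \<open>The completion of a group acting on cosets\<close>

definition coset_action ::
    "('a, 'b) monoid_scheme \<Rightarrow> 'a set \<Rightarrow> 'a \<Rightarrow> 'a set \<Rightarrow> 'a set" where
  "coset_action G H g = (\<lambda>c \<in> lcosets\<^bsub>G\<^esub> H. g <#\<^bsub>G\<^esub> c)"

definition pointwise_nbhd :: "'c set \<Rightarrow> ('c \<Rightarrow> 'c) \<Rightarrow> 'c set \<Rightarrow> ('c \<Rightarrow> 'c) set" where
  "pointwise_nbhd X x F = {y \<in> Bij X. \<forall>c\<in>F. y c = x c}"

definition pointwise_topology :: "'c set \<Rightarrow> ('c \<Rightarrow> 'c) topology" where
  "pointwise_topology X =
    topology_generated_by {pointwise_nbhd X x F | x F. x \<in> Bij X \<and> F \<subseteq> X \<and> finite F}"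

abbreviation BS_cosets :: "int \<Rightarrow> int \<Rightarrow> bs_gen word set set set" where
  "BS_cosets m n \<equiv> lcosets\<^bsub>BS m n\<^esub> (generate (BS m n) {BS_a m n})"

definition BS_closure :: "int \<Rightarrow> int \<Rightarrow> (bs_gen word set set \<Rightarrow> bs_gen word set set) set" where
  "BS_closure m n =
    pointwise_topology (BS_cosets m n) closure_of
      (coset_action (BS m n) (generate (BS m n) {BS_a m n}) ` carrier (BS m n))"

definition G_group :: "int \<Rightarrow> int \<Rightarrow> (bs_gen word set set \<Rightarrow> bs_gen word set set) monoid" where
  "G_group m n = (BijGroup (BS_cosets m n))\<lparr>carrier := BS_closure m n\<rparr>"

definition G_topology :: "int \<Rightarrow> int \<Rightarrow> (bs_gen word set set \<Rightarrow> bs_gen word set set) topology" where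
  "G_topology m n = subtopology (pointwise_topology (BS_cosets m n)) (BS_closure m n)"


section \<open>Scale and flat rank\<close>

text \<open>In this section the group \<open>G\<close> and the topology \<open>\<T>\<close> are meant to form a totally
  disconnected locally compact group.\<close>

definition compact_open_subgroup :: "('a, 'b) monoid_scheme \<Rightarrow> 'a topology \<Rightarrow> 'a set \<Rightarrow> bool" where
  "compact_open_subgroup G \<T> V \<longleftrightarrow> subgroup V G \<and> compactin \<T> V \<and> openin \<T> V"

text \<open>Since \<open>card\<close> of an infinite set is \<open>0\<close>, this is the index only when the index is finite.
  It is used below for an open subgroup of a compact group, where this holds.\<close>

definition subgroup_index :: "('a, 'b) monoid_scheme \<Rightarrow> 'a set \<Rightarrow> 'a set \<Rightarrow> nat" where
  "subgroup_index G V W = card (rcosets\<^bsub>G\<lparr>carrier := V\<rparr>\<^esub> W)"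

definition conj_index :: "('a, 'b) monoid_scheme \<Rightarrow> 'a \<Rightarrow> 'a set \<Rightarrow> nat" where
  "conj_index G x V =
    subgroup_index G V (V \<inter> (\<lambda>v. inv\<^bsub>G\<^esub> x \<otimes>\<^bsub>G\<^esub> v \<otimes>\<^bsub>G\<^esub> x) ` V)"

definition tdlc_scale :: "('a, 'b) monoid_scheme \<Rightarrow> 'a topology \<Rightarrow> 'a \<Rightarrow> nat" where
  "tdlc_scale G \<T> x = (LEAST k. \<exists>V. compact_open_subgroup G \<T> V \<and> k = conj_index G x V)"

definition minimizing :: "('a, 'b) monoid_scheme \<Rightarrow> 'a topology \<Rightarrow> 'a \<Rightarrow> 'a set \<Rightarrow> bool" where
  "minimizing G \<T> x V \<longleftrightarrow> compact_open_subgroup G \<T> V \<and> conj_index G x V = tdlc_scale G \<T> x"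

definition flat_subgroup :: "('a, 'b) monoid_scheme \<Rightarrow> 'a topology \<Rightarrow> 'a set \<Rightarrow> bool" where
  "flat_subgroup G \<T> P \<longleftrightarrow>
    subgroup P G \<and> (\<exists>V. compact_open_subgroup G \<T> V \<and> (\<forall>x\<in>P. minimizing G \<T> x V))"

definition uniscalar_part :: "('a, 'b) monoid_scheme \<Rightarrow> 'a topology \<Rightarrow> 'a set \<Rightarrow> 'a set" where
  "uniscalar_part G \<T> P =
    {x \<in> P. tdlc_scale G \<T> x = 1 \<and> tdlc_scale G \<T> (inv\<^bsub>G\<^esub> x) = 1}"

text \<open>A basis of a free abelian group \<open>A\<close> can be taken inside \<open>A\<close>, so it is no loss that \<open>S\<close> below
  consists of elements of the type of \<open>A\<close>.\<close>

definition free_abelian_of_rank :: "('a, 'b) monoid_scheme \<Rightarrow> enat \<Rightarrow> bool" where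
  "free_abelian_of_rank A r \<longleftrightarrow>
    (\<exists>S :: 'a set. A \<cong> free_Abelian_group S \<and> r = (if finite S then enat (card S) else \<infinity>))"

definition subgroup_flat_rank :: "('a, 'b) monoid_scheme \<Rightarrow> 'a topology \<Rightarrow> 'a set \<Rightarrow> enat" where
  "subgroup_flat_rank G \<T> P =
    (THE r. free_abelian_of_rank ((G\<lparr>carrier := P\<rparr>) Mod uniscalar_part G \<T> P) r)"

definition flat_rank :: "('a, 'b) monoid_scheme \<Rightarrow> 'a topology \<Rightarrow> enat" where
  "flat_rank G \<T> = (SUP P \<in> {P. flat_subgroup G \<T> P}. subgroup_flat_rank G \<T> P)"

end

theory Submission
  imports Defs "HOL-Analysis.Function_Topology"
begin

text \<open>
  Write \<open>X\<close> for the set of cosets of \<open>\<langle>a\<rangle>\<close> and \<open>C\<close> for the closure of the image of \<open>BS(m,n)\<close> in the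
  permutations of \<open>X\<close>. The proof rests on the modular function \<open>\<Delta>(x) = [U : U \<inter> x\<inverse>Ux] / [U : U \<inter> xUx\<inverse>]\<close>,
  which is a homomorphism from \<open>C\<close> to the positive reals and has the same value for every compact open
  subgroup \<open>U\<close>. It takes values in the powers of \<open>\<bar>m / n\<bar>\<close>, and the heart of the matter is that it
  decides uniscalarity: \<open>s(x) = s(x\<inverse>) = 1\<close> holds if and only if \<open>\<Delta>(x) = 1\<close>. Hence, for every subgroup
  \<open>P\<close> of \<open>C\<close>, \<open>P\<^sub>1\<close> is the kernel of \<open>\<Delta>\<close> on \<open>P\<close>, and \<open>P / P\<^sub>1\<close> is isomorphic to a group of
  powers of \<open>\<bar>m / n\<bar>\<close>. So it is trivial or infinite cyclic, and trivial whenever \<open>\<bar>m\<bar> = \<bar>n\<bar>\<close>.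
  This gives the upper bound.

  One direction of the criterion is general: \<open>\<Delta>(x) \<le> s(x)\<close>, so \<open>s(x) = s(x\<inverse>) = 1\<close> forces \<open>\<Delta>(x) = 1\<close>
  (\<open>modular_eq_one_of_uniscalar\<close>). For the other one, let \<open>V N\<close> be the closure of \<open>\<langle>a\<^sup>N\<rangle>\<close>. Every element \<open>g\<close>
  of \<open>BS(m,n)\<close> conjugates some \<open>a\<^sup>N\<close> with \<open>N \<noteq> 0\<close> to some \<open>a\<^sup>N\<^sup>'\<close>, and \<open>\<Delta>(g) = \<bar>N / N'\<bar>\<close>
  (\<open>modular_act_eq_ratio\<close>). If \<open>\<Delta>(g) = 1\<close>, then \<open>N' = \<plusminus>N\<close> and \<open>g\<close> normalizes the compact open group
  \<open>V N\<close>. A general element of \<open>C\<close> is a product of such a \<open>g\<close> and an element of the stabilizer \<open>V 1\<close> of the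
  base coset, and \<open>V 1\<close> is abelian, so it normalizes every \<open>V N\<close> (\<open>normalizes_of_modular_one\<close>).

  The formula for \<open>\<Delta>(g)\<close> reduces to \<open>\<Delta>(t) = \<bar>m / n\<bar>\<close> (\<open>modular_t\<close>). Put \<open>d = gcd m n\<close>, \<open>m = d m'\<close> and
  \<open>n = d n'\<close>. The index of \<open>V 1 \<inter> t\<^sup>-\<^sup>k (V 1) t\<^sup>k\<close> in \<open>V 1\<close> is at most \<open>d \<bar>m'\<bar>\<^sup>k\<close>, because \<open>t\<^sup>k\<close>
  conjugates \<open>a\<close> to the power \<open>d m'\<^sup>k\<close> to \<open>a\<close> to the power \<open>d n'\<^sup>k\<close>, and it is at least \<open>\<bar>m'\<bar>\<^sup>k\<close>, by the affine action of
  \<open>BS(m,n)\<close> on the rationals in which \<open>a\<close> adds \<open>1\<close> and \<open>t\<close> multiplies by \<open>n / m\<close>. The same holds for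
  \<open>t\<^sup>-\<^sup>k\<close> with \<open>n'\<close> in place of \<open>m'\<close>. So \<open>\<Delta>(t)\<^sup>k\<close> differs from \<open>\<bar>m' / n'\<bar>\<^sup>k\<close> by at most the factor \<open>d\<close> for
  all \<open>k\<close>, which leaves only one value of \<open>\<Delta>(t)\<close>.

  Rank \<open>1\<close> is attained for \<open>\<bar>m\<bar> \<noteq> \<bar>n\<bar>\<close> by \<open>\<langle>t\<rangle>\<close>, because \<open>V d\<close> is minimizing for all powers of \<open>t\<close>
  (\<open>minimizing_V\<close>): its index for \<open>t\<^sup>k\<close> is at most \<open>\<bar>m'\<bar>\<^sup>k\<close>, while for an arbitrary compact open \<open>U\<close> the
  indices \<open>A\<close>, \<open>B\<close> that belong to \<open>t\<^sup>k\<close> and \<open>t\<^sup>-\<^sup>k\<close> satisfy \<open>A \<bar>n'\<bar>\<^sup>k = B \<bar>m'\<bar>\<^sup>k\<close>, so that \<open>\<bar>m'\<bar>\<^sup>k\<close> divides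
  \<open>A\<close>.
\<close>

section \<open>Relative indices of subgroups\<close>

lemma finite_card_image_eq_of_same_fibres:
  assumes "\<And>a b. a \<in> A \<Longrightarrow> b \<in> A \<Longrightarrow> f a = f b \<longleftrightarrow> g a = g b"
  shows "finite (f ` A) \<longleftrightarrow> finite (g ` A)" "card (f ` A) = card (g ` A)"
proof -
  have "bij_betw (\<lambda>y. g (inv_into A f y)) (f ` A) (g ` A)"
  proof (rule bij_betw_imageI)
    show "inj_on (\<lambda>y. g (inv_into A f y)) (f ` A)"
    proof (rule inj_onI)
      fix u v
      assume uv: "u \<in> f ` A" "v \<in> f ` A" "g (inv_into A f u) = g (inv_into A f v)"
      then have "f (inv_into A f u) = f (inv_into A f v)" using assms by (simp add: inv_into_into)
      then show "u = v" using uv by (simp add: f_inv_into_f)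
    qed
    show "(\<lambda>y. g (inv_into A f y)) ` f ` A = g ` A"
    proof -
      have "g (inv_into A f (f a)) = g a" if "a \<in> A" for a
        using assms[of "inv_into A f (f a)" a] that by (metis f_inv_into_f image_eqI inv_into_into)
      then show ?thesis by (auto simp: image_iff)
    qed
  qed
  then show "finite (f ` A) \<longleftrightarrow> finite (g ` A)" "card (f ` A) = card (g ` A)"
    using bij_betw_finite bij_betw_same_card by blast+
qed

text \<open>For subgroups \<open>A\<close> and \<open>B\<close> these cosets correspond to the cosets of \<open>A \<inter> B\<close> in \<open>A\<close>. Using \<open>B\<close> itself
  makes images under conjugation and comparisons of three subgroups easier to state.\<close>

definition rel_cosets :: "('a, 'b) monoid_scheme \<Rightarrow> 'a set \<Rightarrow> 'a set \<Rightarrow> 'a set set" where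
  "rel_cosets G A B = (\<lambda>a. B #>\<^bsub>G\<^esub> a) ` A"

definition rel_index :: "('a, 'b) monoid_scheme \<Rightarrow> 'a set \<Rightarrow> 'a set \<Rightarrow> nat" where
  "rel_index G A B = card (rel_cosets G A B)"

text \<open>This is \<open>\<mu> A / \<mu> B\<close> for any Haar measure \<open>\<mu>\<close> if \<open>A\<close> and \<open>B\<close> are compact open subgroups.\<close>

definition index_ratio :: "('a, 'b) monoid_scheme \<Rightarrow> 'a set \<Rightarrow> 'a set \<Rightarrow> real" where
  "index_ratio G A B = real (rel_index G A B) / real (rel_index G B A)"

definition conjugate :: "('a, 'b) monoid_scheme \<Rightarrow> 'a \<Rightarrow> 'a set \<Rightarrow> 'a set" where
  "conjugate G x A = (\<lambda>v. inv\<^bsub>G\<^esub> x \<otimes>\<^bsub>G\<^esub> v \<otimes>\<^bsub>G\<^esub> x) ` A"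

context group
begin

lemma r_coset_eq_iff:
  assumes "subgroup B G" "a \<in> carrier G" "b \<in> carrier G"
  shows "B #> a = B #> b \<longleftrightarrow> a \<otimes> inv b \<in> B"
  using assms rcos_self[OF assms(2,1)] repr_independence[of a B b] subgroup.rcos_module[OF assms(1) is_group assms(3,2)]
  by auto

lemma rel_cosets_Int:
  assumes "subgroup A G" "subgroup B G"
  shows "finite (rel_cosets G A (A \<inter> B)) \<longleftrightarrow> finite (rel_cosets G A B)"
    and "rel_index G A (A \<inter> B) = rel_index G A B"
proof -
  have *: "(A \<inter> B) #> a = (A \<inter> B) #> b \<longleftrightarrow> B #> a = B #> b" if "a \<in> A" "b \<in> A" for a b
  proof -
    have "a \<in> carrier G" "b \<in> carrier G" "a \<otimes> inv b \<in> A"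
      using assms(1) that by (auto simp: subgroup.mem_carrier subgroup.m_closed subgroup.m_inv_closed)
    then show ?thesis
      using assms subgroups_Inter_pair by (simp add: r_coset_eq_iff)
  qed
  show "finite (rel_cosets G A (A \<inter> B)) \<longleftrightarrow> finite (rel_cosets G A B)"
    and "rel_index G A (A \<inter> B) = rel_index G A B"
    unfolding rel_cosets_def rel_index_def
    using finite_card_image_eq_of_same_fibres[of A "\<lambda>a. (A \<inter> B) #> a" "\<lambda>a. B #> a"] * by auto
qed

text \<open>A coset of \<open>C\<close> in \<open>A\<close> is determined by the coset of \<open>B\<close> that contains it and, after translation by a
  chosen representative of that coset, a coset of \<open>C\<close> in \<open>B\<close>.\<close>

lemma rel_cosets_tower:
  assumes "subgroup A G" "subgroup B G" "subgroup C G" "C \<subseteq> B" "B \<subseteq> A"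
    and "finite (rel_cosets G A B)" "finite (rel_cosets G B C)"
  shows "finite (rel_cosets G A C)" "rel_index G A C = rel_index G A B * rel_index G B C"
proof -
  define rep where "rep = inv_into A (\<lambda>a. B #> a)"
  \<comment> \<open>\<open>f\<close> has the same fibres as \<open>\<lambda>a. C #> a\<close>, and its image is the full product.\<close>
  define f where "f = (\<lambda>a. (B #> a, C #> (a \<otimes> inv (rep (B #> a)))))"
  have carr: "a \<in> carrier G" if "a \<in> A" for a using assms(1) that subgroup.mem_carrier by metis
  have rep: "rep (B #> a) \<in> A" "B #> rep (B #> a) = B #> a" if "a \<in> A" for a
    unfolding rep_def using that
    by (auto intro!: inv_into_into f_inv_into_f[where f = "\<lambda>a. B #> a"])
  have repB: "a \<otimes> inv (rep (B #> a)) \<in> B" if "a \<in> A" for a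
    using rep[OF that] carr that r_coset_eq_iff[OF assms(2)] by metis
  have same: "f a = f b \<longleftrightarrow> C #> a = C #> b" if "a \<in> A" "b \<in> A" for a b
  proof -
    have eq: "(a \<otimes> inv r) \<otimes> inv (b \<otimes> inv r) = a \<otimes> inv b" if "r \<in> A" for r
    proof -
      have c: "a \<in> carrier G" "b \<in> carrier G" "r \<in> carrier G"
        using carr \<open>a \<in> A\<close> \<open>b \<in> A\<close> that by auto
      have "inv r \<otimes> (r \<otimes> inv b) = inv b" using c by (simp add: m_assoc[symmetric])
      then show ?thesis using c by (simp add: inv_mult_group m_assoc)
    qed
    have "C #> a = C #> b \<Longrightarrow> B #> a = B #> b"
      using assms(4) carr that r_coset_eq_iff[OF assms(2)] r_coset_eq_iff[OF assms(3)] by auto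
    moreover have "C #> (a \<otimes> inv (rep (B #> a))) = C #> (b \<otimes> inv (rep (B #> a))) \<longleftrightarrow> C #> a = C #> b"
      using eq[OF rep(1)] rep(1) carr that r_coset_eq_iff[OF assms(3)] by simp
    ultimately show ?thesis unfolding f_def by auto
  qed
  have img: "f ` A = rel_cosets G A B \<times> rel_cosets G B C"
  proof
    show "f ` A \<subseteq> rel_cosets G A B \<times> rel_cosets G B C"
      using repB unfolding f_def rel_cosets_def by auto
    show "rel_cosets G A B \<times> rel_cosets G B C \<subseteq> f ` A"
    proof
      fix p assume "p \<in> rel_cosets G A B \<times> rel_cosets G B C"
      then obtain a b where p: "p = (B #> a, C #> b)" "a \<in> A" "b \<in> B"
        unfolding rel_cosets_def by auto
      define r where "r = rep (B #> a)"
      have r: "r \<in> A" "B #> r = B #> a" using rep p unfolding r_def by auto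
      have bc: "b \<in> A" "b \<in> carrier G" "r \<in> carrier G" using p assms(5) carr r by auto
      have "b \<otimes> r \<in> A" using bc r assms(1) by (simp add: subgroup.m_closed)
      moreover have "B #> (b \<otimes> r) = B #> a"
        using r bc p by (metis assms(2) coset_join2 coset_mult_assoc subgroup.subset)
      moreover have "b \<otimes> r \<otimes> inv r = b" using bc by (simp add: m_assoc)
      ultimately show "p \<in> f ` A"
        unfolding f_def p(1) r_def[symmetric] image_iff by (metis r_def)
    qed
  qed
  have fin: "finite (f ` A)" using img assms by simp
  show "finite (rel_cosets G A C)"
    using fin finite_card_image_eq_of_same_fibres(1)[of A f "\<lambda>a. C #> a"] same
    unfolding rel_cosets_def by auto
  have "card (f ` A) = card ((\<lambda>a. C #> a) ` A)"
    by (rule finite_card_image_eq_of_same_fibres(2)) (rule same)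
  then show "rel_index G A C = rel_index G A B * rel_index G B C"
    by (simp add: img card_cartesian_product rel_index_def rel_cosets_def)
qed

lemma rel_index_Int_Int:
  assumes "subgroup A G" "subgroup B G" "subgroup C G"
    and "finite (rel_cosets G A B)" "finite (rel_cosets G B C)"
  shows "rel_index G A (A \<inter> B \<inter> C) = rel_index G A B * rel_index G (A \<inter> B) C"
proof -
  have AB: "subgroup (A \<inter> B) G" and ABC: "subgroup (A \<inter> B \<inter> C) G"
    using assms subgroups_Inter_pair by auto
  have "rel_cosets G (A \<inter> B) C \<subseteq> rel_cosets G B C" unfolding rel_cosets_def by auto
  then have "finite (rel_cosets G (A \<inter> B) C)" using assms finite_subset by blast
  then have "finite (rel_cosets G (A \<inter> B) (A \<inter> B \<inter> C))" using rel_cosets_Int(1) AB assms by blast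
  then have "rel_index G A (A \<inter> B \<inter> C) = rel_index G A (A \<inter> B) * rel_index G (A \<inter> B) (A \<inter> B \<inter> C)"
    using rel_cosets_tower(2)[OF assms(1) AB ABC] rel_cosets_Int(1)[of A B] assms by auto
  then show ?thesis using rel_cosets_Int(2) AB assms by simp
qed

lemma rel_index_pos:
  assumes "subgroup A G" "finite (rel_cosets G A B)"
  shows "rel_index G A B > 0"
  using assms subgroup.one_closed[OF assms(1)] unfolding rel_index_def rel_cosets_def
  by (auto simp: card_gt_0_iff)

text \<open>Each of the three ratios can be computed from the indices of the triple intersection, which then
  cancel.\<close>

lemma index_ratio_cocycle:
  assumes "subgroup A G" "subgroup B G" "subgroup C G"
    and "\<And>X Y. X \<in> {A, B, C} \<Longrightarrow> Y \<in> {A, B, C} \<Longrightarrow> finite (rel_cosets G X Y)"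
  shows "index_ratio G A B * index_ratio G B C = index_ratio G A C"
proof -
  let ?i = "\<lambda>X. real (rel_index G X (A \<inter> B \<inter> C))"
  have *: "index_ratio G X Y = real (rel_index G X (X \<inter> Y \<inter> Z)) / real (rel_index G Y (X \<inter> Y \<inter> Z))
    \<and> rel_index G X (X \<inter> Y \<inter> Z) > 0 \<and> rel_index G Y (X \<inter> Y \<inter> Z) > 0"
    if "X \<in> {A, B, C}" "Y \<in> {A, B, C}" "Z \<in> {A, B, C}" for X Y Z
  proof -
    have s: "subgroup X G" "subgroup Y G" "subgroup Z G" using that assms by auto
    have f: "finite (rel_cosets G X Y)" "finite (rel_cosets G Y X)" "finite (rel_cosets G X Z)"
       "finite (rel_cosets G Y Z)"
      using that assms(4) by auto
    have "rel_index G X (X \<inter> Y \<inter> Z) = rel_index G X Y * rel_index G (X \<inter> Y) Z"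
      "rel_index G Y (X \<inter> Y \<inter> Z) = rel_index G Y X * rel_index G (X \<inter> Y) Z"
      using rel_index_Int_Int[of X Y Z] rel_index_Int_Int[of Y X Z] s f by (auto simp: Int_commute)
    moreover have "rel_index G X Y > 0" "rel_index G Y X > 0" using rel_index_pos s f by auto
    moreover have "rel_index G (X \<inter> Y) Z > 0"
    proof -
      have "rel_cosets G (X \<inter> Y) Z \<subseteq> rel_cosets G Y Z" unfolding rel_cosets_def by auto
      then show ?thesis using f s subgroups_Inter_pair rel_index_pos finite_subset by metis
    qed
    ultimately show ?thesis unfolding index_ratio_def by auto
  qed
  have e: "A \<inter> C \<inter> B = A \<inter> B \<inter> C" "B \<inter> C \<inter> A = A \<inter> B \<inter> C" by auto
  from *[of A B C] *[of B C A] *[of A C B] show ?thesis unfolding e by simp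
qed

lemma conjugate_subgroup:
  assumes "subgroup A G" "x \<in> carrier G"
  shows "subgroup (conjugate G x A) G"
proof (rule subgroupI)
  have carr: "v \<in> carrier G" if "v \<in> A" for v using assms that subgroup.mem_carrier by metis
  show "conjugate G x A \<subseteq> carrier G" unfolding conjugate_def using carr assms by auto
  show "conjugate G x A \<noteq> {}" unfolding conjugate_def using assms subgroup.one_closed by fastforce
  fix a assume "a \<in> conjugate G x A"
  then obtain v where v: "v \<in> A" "a = inv x \<otimes> v \<otimes> x" unfolding conjugate_def by auto
  have "inv a = inv x \<otimes> inv v \<otimes> x" using v assms carr by (simp add: inv_mult_group m_assoc)
  then show "inv a \<in> conjugate G x A"
    unfolding conjugate_def using v assms subgroup.m_inv_closed by (metis image_eqI)
  fix b assume "b \<in> conjugate G x A"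
  then obtain w where w: "w \<in> A" "b = inv x \<otimes> w \<otimes> x" unfolding conjugate_def by auto
  have "x \<otimes> (inv x \<otimes> (w \<otimes> x)) = w \<otimes> x"
    using w assms carr by (simp add: m_assoc[symmetric])
  then have "a \<otimes> b = inv x \<otimes> (v \<otimes> w) \<otimes> x" using v w assms carr by (simp add: m_assoc)
  then show "a \<otimes> b \<in> conjugate G x A"
    unfolding conjugate_def using v w assms subgroup.m_closed by (metis image_eqI)
qed

lemma conjugate_conjugate:
  assumes "A \<subseteq> carrier G" "x \<in> carrier G" "y \<in> carrier G"
  shows "conjugate G y (conjugate G x A) = conjugate G (x \<otimes> y) A"
  using assms unfolding conjugate_def image_image
  by (intro image_cong) (auto simp: inv_mult_group m_assoc subset_iff)

lemma conjugate_one: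
  assumes "A \<subseteq> carrier G"
  shows "conjugate G \<one> A = A"
  using assms unfolding conjugate_def by (auto simp: image_iff subset_iff)

lemma rel_index_conjugate:
  assumes "subgroup A G" "subgroup B G" "x \<in> carrier G"
  shows "rel_index G (conjugate G x A) (conjugate G x B) = rel_index G A B"
proof -
  let ?c = "\<lambda>v. inv x \<otimes> v \<otimes> x"
  have "conjugate G x B #> ?c a = conjugate G x B #> ?c b \<longleftrightarrow> B #> a = B #> b" if "a \<in> A" "b \<in> A" for a b
  proof -
    have c: "a \<in> carrier G" "b \<in> carrier G" using that assms subgroup.mem_carrier by metis+
    have "x \<otimes> (inv x \<otimes> (inv b \<otimes> x)) = inv b \<otimes> x"
      using c assms by (simp add: m_assoc[symmetric])
    then have "?c a \<otimes> inv (?c b) = ?c (a \<otimes> inv b)" using c assms by (simp add: inv_mult_group m_assoc)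
    moreover have "?c u \<in> conjugate G x B \<longleftrightarrow> u \<in> B" if "u \<in> carrier G" for u
    proof
      assume "?c u \<in> conjugate G x B"
      then obtain v where v: "v \<in> B" "?c u = ?c v" unfolding conjugate_def by auto
      moreover have "x \<otimes> ?c w \<otimes> inv x = w" if "w \<in> carrier G" for w
        using that assms(3) by (metis inv_closed inv_inv m_assoc m_closed r_inv l_one r_one)
      ultimately have "u = v" using that subgroup.mem_carrier[OF assms(2) v(1)] by metis
      then show "u \<in> B" using v by simp
    qed (auto simp: conjugate_def)
    ultimately show ?thesis
      using r_coset_eq_iff[OF assms(2)] r_coset_eq_iff[OF conjugate_subgroup[OF assms(2,3)]] c assms by auto
  qed
  then show ?thesis unfolding rel_index_def rel_cosets_def
    using finite_card_image_eq_of_same_fibres(2)[of A "\<lambda>a. conjugate G x B #> ?c a" "\<lambda>a. B #> a"]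
    by (metis (no_types, lifting) conjugate_def image_cong image_image)
qed

lemma conj_index_eq_rel_index:
  assumes "subgroup V G" "x \<in> carrier G"
  shows "conj_index G x V = rel_index G V (conjugate G x V)"
proof -
  have "subgroup_index G V W = rel_index G V W" for W
    unfolding subgroup_index_def RCOSETS_def rel_index_def rel_cosets_def
    by (simp add: UNION_singleton_eq_range)
  then show ?thesis
    unfolding conj_index_def conjugate_def[symmetric]
    using rel_cosets_Int(2) assms conjugate_subgroup by simp
qed

end

section \<open>The modular function and the scale\<close>

text \<open>These are the properties of the compact open subgroups of a totally disconnected locally compact
  group on which the modular function and its relation to the scale depend.\<close>

locale commensurated_group = group G for G (structure) +
  fixes T
  assumes compact_open_finite_index:
      "\<And>U W. compact_open_subgroup G T U \<Longrightarrow> compact_open_subgroup G T W \<Longrightarrow> finite (rel_cosets G U W)"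
    and compact_open_conjugate:
      "\<And>U x. compact_open_subgroup G T U \<Longrightarrow> x \<in> carrier G \<Longrightarrow> compact_open_subgroup G T (conjugate G x U)"
    and compact_open_exists: "\<exists>U. compact_open_subgroup G T U"
begin

definition base where "base = (SOME U. compact_open_subgroup G T U)"

text \<open>By \<open>modular_eq\<close> below, the choice of the base subgroup does not matter.\<close>

definition modular where "modular x = index_ratio G base (conjugate G x base)"

lemma base: "compact_open_subgroup G T base"
  unfolding base_def using compact_open_exists by (rule someI_ex)

lemma compact_open_is_subgroup: "compact_open_subgroup G T U \<Longrightarrow> subgroup U G"
  by (simp add: compact_open_subgroup_def)

lemma compact_open_rel_index_pos:
  "compact_open_subgroup G T U \<Longrightarrow> compact_open_subgroup G T W \<Longrightarrow> rel_index G U W > 0"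
  by (simp add: compact_open_finite_index compact_open_is_subgroup rel_index_pos)

lemma compact_open_cocycle:
  assumes "compact_open_subgroup G T A" "compact_open_subgroup G T B" "compact_open_subgroup G T C"
  shows "index_ratio G A B * index_ratio G B C = index_ratio G A C"
  by (rule index_ratio_cocycle) (use assms in \<open>auto intro: compact_open_is_subgroup compact_open_finite_index\<close>)

lemma index_ratio_conjugate:
  assumes "compact_open_subgroup G T A" "compact_open_subgroup G T B" "x \<in> carrier G"
  shows "index_ratio G (conjugate G x A) (conjugate G x B) = index_ratio G A B"
  using assms by (simp add: index_ratio_def rel_index_conjugate compact_open_is_subgroup)

lemma index_ratio_pos:
  assumes "compact_open_subgroup G T A" "compact_open_subgroup G T B"
  shows "index_ratio G A B > 0"
  using assms by (simp add: index_ratio_def compact_open_rel_index_pos)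

text \<open>Passing from the base subgroup to \<open>U\<close> changes the ratio by a factor for the pair \<open>(U, base)\<close> and one
  for the conjugated pair; by conjugation invariance these cancel.\<close>

lemma modular_eq:
  assumes U: "compact_open_subgroup G T U" and x: "x \<in> carrier G"
  shows "modular x = index_ratio G U (conjugate G x U)"
proof -
  note cx = compact_open_conjugate[OF _ x]
  have "index_ratio G U (conjugate G x U) =
      index_ratio G U base * (index_ratio G base (conjugate G x base)
        * index_ratio G (conjugate G x base) (conjugate G x U))"
    using compact_open_cocycle U base cx by simp
  also have "\<dots> = (index_ratio G U base * index_ratio G base U) * modular x"
    using index_ratio_conjugate[OF base U x] by (simp add: modular_def)
  also have "index_ratio G U base * index_ratio G base U = 1"
    using compact_open_rel_index_pos[OF U base] compact_open_rel_index_pos[OF base U]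
    by (simp add: index_ratio_def)
  finally show ?thesis by simp
qed

lemma modular_pos: "x \<in> carrier G \<Longrightarrow> modular x > 0"
  unfolding modular_def using base compact_open_conjugate index_ratio_pos by blast

lemma modular_mult:
  assumes "x \<in> carrier G" "y \<in> carrier G"
  shows "modular (x \<otimes> y) = modular x * modular y"
proof -
  let ?c = "conjugate G"
  have "modular (x \<otimes> y) = index_ratio G base (?c y (?c x base))"
    unfolding modular_def
    using conjugate_conjugate[of base x y] compact_open_is_subgroup[OF base] subgroup.subset assms by metis
  also have "\<dots> = index_ratio G base (?c y base) * index_ratio G (?c y base) (?c y (?c x base))"
    using compact_open_cocycle base compact_open_conjugate assms by simp
  also have "\<dots> = modular y * modular x"
    using index_ratio_conjugate[OF base compact_open_conjugate[OF base assms(1)] assms(2)] by (simp add: modular_def)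
  finally show ?thesis by simp
qed

lemma modular_normalizer:
  assumes "compact_open_subgroup G T U" "x \<in> carrier G" "conjugate G x U = U"
  shows "modular x = 1"
  using modular_eq[OF assms(1,2)] compact_open_rel_index_pos[OF assms(1,1)] assms(3)
  by (simp add: index_ratio_def)

lemma modular_one: "modular \<one> = 1"
  using modular_normalizer[OF base] conjugate_one compact_open_is_subgroup[OF base] subgroup.subset by blast

lemma modular_inv: "x \<in> carrier G \<Longrightarrow> modular (inv x) = 1 / modular x"
  using modular_mult[of x "inv x"] modular_pos[of x] by (simp add: modular_one field_simps)

lemma conj_index_pos:
  assumes "compact_open_subgroup G T U" "x \<in> carrier G"
  shows "conj_index G x U > 0"
  using assms conj_index_eq_rel_index compact_open_is_subgroup compact_open_conjugate compact_open_rel_index_pos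
  by simp

text \<open>The index of \<open>U \<inter> x\<inverse>Ux\<close> in \<open>x\<inverse>Ux\<close> becomes, after conjugation back by \<open>x\<close>, the index that belongs to
  \<open>x\<inverse>\<close> and \<open>U\<close>.\<close>

lemma conj_index_modular:
  assumes U: "compact_open_subgroup G T U" and x: "x \<in> carrier G"
  shows "real (conj_index G x U) = modular x * real (conj_index G (inv x) U)"
proof -
  have s: "subgroup U G" using U by (rule compact_open_is_subgroup)
  have "conjugate G x (conjugate G (inv x) U) = U"
    using conjugate_conjugate[of U "inv x" x] conjugate_one[of U] s x by (simp add: subgroup.subset)
  then have "rel_index G (conjugate G x U) U = rel_index G U (conjugate G (inv x) U)"
    using rel_index_conjugate[OF s conjugate_subgroup[OF s], of "inv x" x] x by simp
  then have "modular x = real (conj_index G x U) / real (conj_index G (inv x) U)"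
    using modular_eq[OF U x] s x by (simp add: index_ratio_def conj_index_eq_rel_index)
  then show ?thesis using conj_index_pos[OF U, of "inv x"] x by simp
qed

lemma scale_attained: "\<exists>U. compact_open_subgroup G T U \<and> tdlc_scale G T x = conj_index G x U"
  unfolding tdlc_scale_def by (rule LeastI_ex) (use base in blast)

lemma scale_le: "compact_open_subgroup G T U \<Longrightarrow> tdlc_scale G T x \<le> conj_index G x U"
  unfolding tdlc_scale_def by (rule Least_le) blast

text \<open>At a minimizing subgroup the scale is \<open>\<Delta>(x)\<close> times an index, and an index is at least \<open>1\<close>.\<close>

lemma modular_le_scale:
  assumes "x \<in> carrier G"
  shows "modular x \<le> real (tdlc_scale G T x)"
proof -
  obtain U where U: "compact_open_subgroup G T U" "tdlc_scale G T x = conj_index G x U"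
    using scale_attained by blast
  have "1 \<le> real (conj_index G (inv x) U)" using conj_index_pos[OF U(1), of "inv x"] assms by simp
  then show ?thesis using conj_index_modular[OF U(1) assms] modular_pos[OF assms] U(2) by simp
qed

lemma scale_eq_one_of_normalizer:
  assumes "compact_open_subgroup G T U" "x \<in> carrier G" "conjugate G x U = U"
  shows "tdlc_scale G T x = 1"
proof -
  have "rel_cosets G U U = {U}"
    using coset_join2 subgroup.mem_carrier[OF compact_open_is_subgroup[OF assms(1)]]
      subgroup.one_closed[OF compact_open_is_subgroup[OF assms(1)]] compact_open_is_subgroup[OF assms(1)]
    unfolding rel_cosets_def by auto
  then have "conj_index G x U = 1"
    using assms conj_index_eq_rel_index[OF compact_open_is_subgroup[OF assms(1)] assms(2)]
    by (simp add: rel_index_def)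
  then have "tdlc_scale G T x \<le> 1" using scale_le[OF assms(1), of x] by simp
  moreover have "tdlc_scale G T x > 0" using scale_attained[of x] conj_index_pos assms(2) by metis
  ultimately show ?thesis by simp
qed

lemma modular_eq_one_of_uniscalar:
  assumes "x \<in> carrier G" "tdlc_scale G T x = 1" "tdlc_scale G T (inv x) = 1"
  shows "modular x = 1"
  using modular_le_scale[of x] modular_le_scale[of "inv x"] modular_inv[of x] modular_pos[of x] assms
  by (simp add: field_simps)

end

section \<open>The topology of pointwise convergence\<close>

text \<open>An elementary description of the closure in the topology of pointwise convergence, see
  \<open>closure_of_pointwise_topology\<close>.\<close>

definition pointwise_closure :: "'c set \<Rightarrow> ('c \<Rightarrow> 'c) set \<Rightarrow> ('c \<Rightarrow> 'c) set" where
  "pointwise_closure X S =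
    {x \<in> Bij X. \<forall>F. finite F \<and> F \<subseteq> X \<longrightarrow> (\<exists>s\<in>S. \<forall>c\<in>F. s c = x c)}"

lemma pointwise_nbhd_shrink:
  "y \<in> pointwise_nbhd X x F \<Longrightarrow> pointwise_nbhd X y F \<subseteq> pointwise_nbhd X x F"
  by (auto simp: pointwise_nbhd_def)

lemma openin_pointwise_nbhd:
  "\<lbrakk>x \<in> Bij X; F \<subseteq> X; finite F\<rbrakk> \<Longrightarrow> openin (pointwise_topology X) (pointwise_nbhd X x F)"
  unfolding pointwise_topology_def by (rule topology_generated_by_Basis) blast

text \<open>The generating sets are closed under finite intersections at each of their points, so they form
  a base and not merely a subbase.\<close>

lemma openin_pointwise_imp_nbhd:
  assumes "openin (pointwise_topology X) U" "x \<in> U"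
  shows "\<exists>F. finite F \<and> F \<subseteq> X \<and> pointwise_nbhd X x F \<subseteq> U"
proof -
  have "generate_topology_on {pointwise_nbhd X x F | x F. x \<in> Bij X \<and> F \<subseteq> X \<and> finite F} U"
    using assms(1) unfolding pointwise_topology_def openin_topology_generated_by_iff .
  then show ?thesis using assms(2)
  proof (induction arbitrary: x)
    case Empty
    then show ?case by simp
  next
    case (Int a b)
    obtain F where F: "finite F" "F \<subseteq> X" "pointwise_nbhd X x F \<subseteq> a"
      using Int.IH(1)[of x] Int.prems by (metis IntD1 IntD2)
    obtain F' where F': "finite F'" "F' \<subseteq> X" "pointwise_nbhd X x F' \<subseteq> b"
      using Int.IH(2)[of x] Int.prems by (metis IntD1 IntD2)
    have "pointwise_nbhd X x (F \<union> F') \<subseteq> a \<inter> b" using F F' by (auto simp: pointwise_nbhd_def)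
    then show ?case using F F' by (intro exI[of _ "F \<union> F'"]) simp
  next
    case (UN K)
    then show ?case by (meson UnionE Union_upper order_trans)
  next
    case (Basis s)
    then obtain y F where "s = pointwise_nbhd X y F" "F \<subseteq> X" "finite F" by auto
    then show ?case using pointwise_nbhd_shrink[of x X y F] Basis.prems by (intro exI[of _ F]) simp
  qed
qed

lemma pointwise_nbhd_self: "x \<in> Bij X \<Longrightarrow> x \<in> pointwise_nbhd X x F"
  by (simp add: pointwise_nbhd_def)

lemma topspace_pointwise_topology: "topspace (pointwise_topology X) = Bij X"
proof
  show "topspace (pointwise_topology X) \<subseteq> Bij X"
    unfolding pointwise_topology_def by (auto simp: pointwise_nbhd_def)
  show "Bij X \<subseteq> topspace (pointwise_topology X)"
    using openin_pointwise_nbhd[of _ X "{}"] openin_subset pointwise_nbhd_self by fastforce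
qed

lemma closure_of_pointwise_topology:
  "S \<subseteq> Bij X \<Longrightarrow> pointwise_topology X closure_of S = pointwise_closure X S"
proof (intro equalityI subsetI)
  fix x assume S: "S \<subseteq> Bij X" and x: "x \<in> pointwise_topology X closure_of S"
  have xB: "x \<in> Bij X" using x by (simp add: in_closure_of topspace_pointwise_topology)
  have "\<exists>s\<in>S. \<forall>c\<in>F. s c = x c" if F: "finite F" "F \<subseteq> X" for F
  proof -
    have "\<exists>y. y \<in> S \<and> y \<in> pointwise_nbhd X x F"
      using x openin_pointwise_nbhd[OF xB F(2,1)] pointwise_nbhd_self[OF xB, of F]
      unfolding in_closure_of by simp
    then show ?thesis by (auto simp: pointwise_nbhd_def)
  qed
  then show "x \<in> pointwise_closure X S" using xB by (simp add: pointwise_closure_def)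
next
  fix x assume S: "S \<subseteq> Bij X" and x: "x \<in> pointwise_closure X S"
  have *: "\<exists>y. y \<in> S \<and> y \<in> U" if U: "x \<in> U" "openin (pointwise_topology X) U" for U
  proof -
    obtain F where F: "finite F" "F \<subseteq> X" "pointwise_nbhd X x F \<subseteq> U"
      using openin_pointwise_imp_nbhd[OF U(2,1)] by blast
    obtain s where "s \<in> S" "\<forall>c\<in>F. s c = x c" using x F unfolding pointwise_closure_def by blast
    then have "s \<in> pointwise_nbhd X x F" using S by (auto simp: pointwise_nbhd_def)
    then show ?thesis using F(3) \<open>s \<in> S\<close> by blast
  qed
  have "x \<in> Bij X" using x by (simp add: pointwise_closure_def)
  then show "x \<in> pointwise_topology X closure_of S"
    unfolding in_closure_of topspace_pointwise_topology using * by simp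
qed

lemma Bij_closed: "x \<in> Bij X \<Longrightarrow> c \<in> X \<Longrightarrow> x c \<in> X"
  using Bij_imp_funcset by blast

lemma Bij_eqI:
  assumes "x \<in> Bij X" "y \<in> Bij X" "\<And>c. c \<in> X \<Longrightarrow> x c = y c"
  shows "x = y"
  using assms Bij_imp_extensional extensionalityI by metis

lemma Bij_inj: "x \<in> Bij X \<Longrightarrow> c \<in> X \<Longrightarrow> d \<in> X \<Longrightarrow> x c = x d \<Longrightarrow> c = d"
  unfolding Bij_def bij_betw_def by (auto dest: inj_onD)

lemma carrier_BijGroup: "carrier (BijGroup X) = Bij X"
  by (simp add: BijGroup_def)

lemma BijGroup_mult_app:
  "\<lbrakk>x \<in> Bij X; y \<in> Bij X; c \<in> X\<rbrakk> \<Longrightarrow> (x \<otimes>\<^bsub>BijGroup X\<^esub> y) c = x (y c)"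
  by (simp add: BijGroup_def compose_eq)

lemma BijGroup_one_app: "c \<in> X \<Longrightarrow> \<one>\<^bsub>BijGroup X\<^esub> c = c"
  by (simp add: BijGroup_def)

lemma BijGroup_inv_app:
  assumes "x \<in> Bij X" "c \<in> X"
  shows "(inv\<^bsub>BijGroup X\<^esub> x) (x c) = c" "x ((inv\<^bsub>BijGroup X\<^esub> x) c) = c"
proof -
  interpret group "BijGroup X" by (rule group_BijGroup)
  have x: "x \<in> carrier (BijGroup X)" and i: "inv\<^bsub>BijGroup X\<^esub> x \<in> Bij X"
    using assms inv_closed by (auto simp: carrier_BijGroup)
  show "(inv\<^bsub>BijGroup X\<^esub> x) (x c) = c" "x ((inv\<^bsub>BijGroup X\<^esub> x) c) = c"
    using l_inv[OF x] r_inv[OF x] BijGroup_mult_app[OF i assms(1,2)] BijGroup_mult_app[OF assms(1) i assms(2)]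
      BijGroup_one_app[OF assms(2)] by simp_all
qed

lemma pointwise_closureD:
  "\<lbrakk>x \<in> pointwise_closure X S; finite F; F \<subseteq> X\<rbrakk> \<Longrightarrow> \<exists>s\<in>S. \<forall>c\<in>F. s c = x c"
  by (simp add: pointwise_closure_def)

lemma pointwise_closure_subset_Bij: "pointwise_closure X S \<subseteq> Bij X"
  by (auto simp: pointwise_closure_def)

lemma pointwise_closure_mono: "S \<subseteq> S' \<Longrightarrow> pointwise_closure X S \<subseteq> pointwise_closure X S'"
  unfolding pointwise_closure_def by blast

lemma subset_pointwise_closure: "S \<subseteq> Bij X \<Longrightarrow> S \<subseteq> pointwise_closure X S"
  unfolding pointwise_closure_def by blast

text \<open>An approximation of \<open>x\<close> on the preimage of \<open>F\<close> under \<open>x\<close> gives one of the inverse of \<open>x\<close> on \<open>F\<close>.\<close>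

lemma subgroup_pointwise_closure:
  assumes S: "subgroup S (BijGroup X)"
  shows "subgroup (pointwise_closure X S) (BijGroup X)"
proof -
  interpret B: group "BijGroup X" by (rule group_BijGroup)
  have SB: "S \<subseteq> Bij X" using subgroup.subset[OF S] by (simp add: carrier_BijGroup)
  show ?thesis
  proof (rule B.subgroupI)
    show "pointwise_closure X S \<subseteq> carrier (BijGroup X)"
      by (simp add: carrier_BijGroup pointwise_closure_subset_Bij)
    show "pointwise_closure X S \<noteq> {}"
      using subset_pointwise_closure[OF SB] subgroup.one_closed[OF S] by blast
  next
    fix x assume x: "x \<in> pointwise_closure X S"
    then have xB: "x \<in> Bij X" using pointwise_closure_subset_Bij by blast
    then have iB: "inv\<^bsub>BijGroup X\<^esub> x \<in> Bij X" using B.inv_closed by (simp add: carrier_BijGroup)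
    have "\<exists>s\<in>S. \<forall>c\<in>F. s c = (inv\<^bsub>BijGroup X\<^esub> x) c" if F: "finite F" "F \<subseteq> X" for F
    proof -
      have "(inv\<^bsub>BijGroup X\<^esub> x) ` F \<subseteq> X" using F Bij_closed[OF iB] by auto
      then obtain s where s: "s \<in> S" "\<forall>c\<in>(inv\<^bsub>BijGroup X\<^esub> x) ` F. s c = x c"
        using pointwise_closureD[OF x, of "(inv\<^bsub>BijGroup X\<^esub> x) ` F"] F by blast
      have "(inv\<^bsub>BijGroup X\<^esub> s) c = (inv\<^bsub>BijGroup X\<^esub> x) c" if "c \<in> F" for c
      proof -
        have c: "c \<in> X" "(inv\<^bsub>BijGroup X\<^esub> x) c \<in> X" using that F Bij_closed[OF iB] by auto
        have "s ((inv\<^bsub>BijGroup X\<^esub> x) c) = c" using s(2) that BijGroup_inv_app(2)[OF xB c(1)] by simp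
        then show ?thesis using BijGroup_inv_app(1)[of s X, OF _ c(2)] s(1) SB by auto
      qed
      then show ?thesis using subgroup.m_inv_closed[OF S s(1)] by blast
    qed
    then show "inv\<^bsub>BijGroup X\<^esub> x \<in> pointwise_closure X S" using iB by (simp add: pointwise_closure_def)
  next
    fix x y assume xy: "x \<in> pointwise_closure X S" "y \<in> pointwise_closure X S"
    then have B: "x \<in> Bij X" "y \<in> Bij X" using pointwise_closure_subset_Bij by blast+
    have xyB: "x \<otimes>\<^bsub>BijGroup X\<^esub> y \<in> Bij X"
      using B B.m_closed by (simp add: carrier_BijGroup)
    have "\<exists>s\<in>S. \<forall>c\<in>F. s c = (x \<otimes>\<^bsub>BijGroup X\<^esub> y) c" if F: "finite F" "F \<subseteq> X" for F
    proof -
      obtain u where u: "u \<in> S" "\<forall>c\<in>F. u c = y c" using pointwise_closureD[OF xy(2) F] by blast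
      have "y ` F \<subseteq> X" using F Bij_closed[OF B(2)] by auto
      then obtain s where s: "s \<in> S" "\<forall>c\<in>y ` F. s c = x c"
        using pointwise_closureD[OF xy(1), of "y ` F"] F by blast
      have "(s \<otimes>\<^bsub>BijGroup X\<^esub> u) c = (x \<otimes>\<^bsub>BijGroup X\<^esub> y) c" if "c \<in> F" for c
        using u s that F B SB by (simp add: BijGroup_mult_app subset_iff)
      then show ?thesis using subgroup.m_closed[OF S s(1) u(1)] by blast
    qed
    then show "x \<otimes>\<^bsub>BijGroup X\<^esub> y \<in> pointwise_closure X S" using xyB by (simp add: pointwise_closure_def)
  qed
qed

text \<open>If all orbits are finite, the closure lies in the product of the orbits, which is compact by
  Tychonoff's theorem for discrete factors. It is closed there even among all functions: a pointwise
  limit of elements of \<open>L\<close> is injective and maps each finite orbit into itself, hence onto itself, so it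
  is again a permutation.\<close>

lemma compactin_pointwise_closure:
  assumes L: "L \<subseteq> Bij X" and fin: "\<And>c. c \<in> X \<Longrightarrow> finite ((\<lambda>l. l c) ` L)"
    and maps: "\<And>l c d. l \<in> L \<Longrightarrow> c \<in> X \<Longrightarrow> d \<in> (\<lambda>l. l c) ` L \<Longrightarrow> l d \<in> (\<lambda>l. l c) ` L"
    and refl: "\<And>c. c \<in> X \<Longrightarrow> c \<in> (\<lambda>l. l c) ` L"
  shows "compactin (pointwise_topology X) (pointwise_closure X L)"
proof -
  define orb where "orb = (\<lambda>c. (\<lambda>l. l c) ` L)"
  define P where "P = product_topology (\<lambda>_. discrete_topology X) X"
  have OX: "orb c \<subseteq> X" if "c \<in> X" for c
    unfolding orb_def using subsetD[OF L] Bij_closed[OF _ that] by (intro image_subsetI) simp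
  have tP: "topspace P = (\<Pi>\<^sub>E c\<in>X. X)" by (simp add: P_def)
  have cylinder: "openin P {z \<in> topspace P. \<forall>c\<in>F. z c = y c}" if "finite F" "F \<subseteq> X" "y \<in> topspace P" for F y
  proof -
    have "{z \<in> topspace P. \<forall>c\<in>F. z c = y c} = (\<Pi>\<^sub>E c\<in>X. if c \<in> F then {y c} else X)"
      using that unfolding tP by (fastforce simp: PiE_iff extensional_def split: if_splits)
    moreover have "openin P (\<Pi>\<^sub>E c\<in>X. if c \<in> F then {y c} else X)"
      unfolding P_def openin_PiE_gen
      using that by (auto simp: tP PiE_iff intro: finite_subset)
    ultimately show ?thesis by simp
  qed
  have limit_Bij: "y \<in> Bij X"
    if y: "y \<in> topspace P" and lim: "\<And>F. finite F \<Longrightarrow> F \<subseteq> X \<Longrightarrow> \<exists>l\<in>L. \<forall>c\<in>F. l c = y c" for y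
  proof -
    have "inj_on y X"
    proof (rule inj_onI)
      fix c d assume cd: "c \<in> X" "d \<in> X" "y c = y d"
      then obtain l where "l \<in> L" "l c = y c" "l d = y d" using lim[of "{c, d}"] by auto
      then show "c = d" using cd L Bij_inj[of l X c d] by auto
    qed
    moreover have "y ` X = X"
    proof
      show "y ` X \<subseteq> X" using y unfolding tP by auto
      show "X \<subseteq> y ` X"
      proof
        fix c assume c: "c \<in> X"
        obtain l where l: "l \<in> L" "\<forall>d\<in>orb c. l d = y d"
          using lim[of "orb c"] fin[OF c] OX[OF c] unfolding orb_def by auto
        \<comment> \<open>An injective map of a finite orbit into itself is onto.\<close>
        have "y ` orb c \<subseteq> orb c" using maps[OF l(1) c] l(2) unfolding orb_def by fastforce
        moreover have "inj_on y (orb c)" using \<open>inj_on y X\<close> OX[OF c] inj_on_subset by blast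
        ultimately have "y ` orb c = orb c"
          using endo_inj_surj[of "orb c" y] fin[OF c] unfolding orb_def by blast
        moreover have "c \<in> orb c" using refl[OF c] unfolding orb_def .
        ultimately show "c \<in> y ` X" using OX[OF c] by blast
      qed
    qed
    ultimately show ?thesis using y unfolding tP Bij_def bij_betw_def by (auto simp: PiE_iff)
  qed
  have sub: "pointwise_closure X L \<subseteq> (\<Pi>\<^sub>E c\<in>X. orb c)"
  proof
    fix x assume x: "x \<in> pointwise_closure X L"
    have "x c \<in> orb c" if "c \<in> X" for c
    proof -
      obtain l where "l \<in> L" "l c = x c" using pointwise_closureD[OF x, of "{c}"] \<open>c \<in> X\<close> by auto
      then show ?thesis unfolding orb_def by (metis imageI)
    qed
    moreover have "x \<in> extensional X" using x pointwise_closure_subset_Bij Bij_imp_extensional by blast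
    ultimately show "x \<in> (\<Pi>\<^sub>E c\<in>X. orb c)" by (simp add: PiE_iff)
  qed
  have BijP: "Bij X \<subseteq> topspace P"
    unfolding tP Bij_def by (auto simp: PiE_def bij_betw_def)
  have "closedin P (pointwise_closure X L)"
    unfolding closedin_def
  proof
    show "pointwise_closure X L \<subseteq> topspace P" using BijP pointwise_closure_subset_Bij by blast
    show "openin P (topspace P - pointwise_closure X L)"
    proof (subst openin_subopen, intro ballI)
      fix y assume y: "y \<in> topspace P - pointwise_closure X L"
      then obtain F where F: "finite F" "F \<subseteq> X" "\<not> (\<exists>l\<in>L. \<forall>c\<in>F. l c = y c)"
        using limit_Bij[of y] unfolding pointwise_closure_def by blast
      have "{z \<in> topspace P. \<forall>c\<in>F. z c = y c} \<subseteq> topspace P - pointwise_closure X L"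
      proof
        fix z assume z: "z \<in> {z \<in> topspace P. \<forall>c\<in>F. z c = y c}"
        then have "z \<notin> pointwise_closure X L" using F pointwise_closureD[of z X L F] by force
        then show "z \<in> topspace P - pointwise_closure X L" using z by blast
      qed
      then show "\<exists>U. openin P U \<and> y \<in> U \<and> U \<subseteq> topspace P - pointwise_closure X L"
        using cylinder[OF F(1,2), of y] y by blast
    qed
  qed
  moreover have "compactin P (\<Pi>\<^sub>E c\<in>X. orb c)"
    unfolding P_def compactin_PiE using fin OX by (simp add: orb_def finite_imp_compactin)
  ultimately have "compactin P (pointwise_closure X L)"
    using closed_compactin sub by blast
  then have K: "compactin (subtopology P (Bij X)) (pointwise_closure X L)"
    by (simp add: compactin_subtopology pointwise_closure_subset_Bij)
  have tS: "topspace (subtopology P (Bij X)) = Bij X" using BijP by auto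
  have "continuous_map (subtopology P (Bij X)) (pointwise_topology X) id"
    unfolding continuous_map_def tS topspace_pointwise_topology
  proof (intro conjI allI impI)
    fix U assume U: "openin (pointwise_topology X) U"
    show "openin (subtopology P (Bij X)) {x \<in> Bij X. id x \<in> U}"
    proof (subst openin_subopen, intro ballI)
      fix x assume x: "x \<in> {x \<in> Bij X. id x \<in> U}"
      then obtain F where F: "finite F" "F \<subseteq> X" "pointwise_nbhd X x F \<subseteq> U"
        using openin_pointwise_imp_nbhd[OF U, of x] by auto
      let ?Z = "Bij X \<inter> {z \<in> topspace P. \<forall>c\<in>F. z c = x c}"
      have "openin (subtopology P (Bij X)) ?Z"
        using cylinder[OF F(1,2)] x BijP by (intro openin_subtopology_Int2) blast
      moreover have "x \<in> ?Z" "?Z \<subseteq> {x \<in> Bij X. id x \<in> U}"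
        using x BijP F(3) by (auto simp: pointwise_nbhd_def)
      ultimately show "\<exists>W. openin (subtopology P (Bij X)) W \<and> x \<in> W \<and> W \<subseteq> {x \<in> Bij X. id x \<in> U}"
        by blast
    qed
  qed simp
  from image_compactin[OF K this] show ?thesis by simp
qed

section \<open>Topological groups of permutations\<close>

locale permutation_subgroup =
  fixes X :: "'c set" and C :: "('c \<Rightarrow> 'c) set"
  assumes subgroup_Bij: "subgroup C (BijGroup X)"
begin

abbreviation perm_group where "perm_group \<equiv> (BijGroup X)\<lparr>carrier := C\<rparr>"

abbreviation perm_topology where "perm_topology \<equiv> subtopology (pointwise_topology X) C"

sublocale perm: group perm_group
  by (rule subgroup.subgroup_is_group[OF subgroup_Bij group_BijGroup])

lemma carrier_subset: "C \<subseteq> Bij X"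
  using subgroup.subset[OF subgroup_Bij] by (simp add: carrier_BijGroup)

lemma inv_perm: "x \<in> C \<Longrightarrow> inv\<^bsub>perm_group\<^esub> x = inv\<^bsub>BijGroup X\<^esub> x"
  by (rule group.m_inv_consistent[OF group_BijGroup subgroup_Bij])

lemma perm_closed: "\<lbrakk>x \<in> C; c \<in> X\<rbrakk> \<Longrightarrow> x c \<in> X"
  using carrier_subset Bij_closed[of x X c] by auto

lemma perm_eqI: "\<lbrakk>x \<in> C; y \<in> C; \<And>c. c \<in> X \<Longrightarrow> x c = y c\<rbrakk> \<Longrightarrow> x = y"
  using carrier_subset Bij_eqI[of x X y] by auto

lemma mult_app: "\<lbrakk>x \<in> C; y \<in> C; c \<in> X\<rbrakk> \<Longrightarrow> (x \<otimes>\<^bsub>perm_group\<^esub> y) c = x (y c)"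
  using carrier_subset BijGroup_mult_app[of x X y c] by auto

lemma one_app: "c \<in> X \<Longrightarrow> \<one>\<^bsub>perm_group\<^esub> c = c"
  using BijGroup_one_app by simp

lemma inv_app:
  assumes "x \<in> C" "c \<in> X"
  shows "(inv\<^bsub>perm_group\<^esub> x) (x c) = c" "x ((inv\<^bsub>perm_group\<^esub> x) c) = c"
  using assms carrier_subset BijGroup_inv_app[of x X c] inv_perm by auto

lemma mult_perm_closed: "\<lbrakk>x \<in> C; y \<in> C\<rbrakk> \<Longrightarrow> x \<otimes>\<^bsub>perm_group\<^esub> y \<in> C"
  using perm.m_closed by simp

lemma inv_perm_closed: "x \<in> C \<Longrightarrow> inv\<^bsub>perm_group\<^esub> x \<in> C"
  using perm.inv_closed by simp

lemma topspace_perm_topology: "topspace perm_topology = C"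
  using carrier_subset by (auto simp: topspace_pointwise_topology)

lemma openin_perm_topology_iff:
  "openin perm_topology U \<longleftrightarrow>
    U \<subseteq> C \<and> (\<forall>x\<in>U. \<exists>F. finite F \<and> F \<subseteq> X \<and> (\<forall>y\<in>C. (\<forall>c\<in>F. y c = x c) \<longrightarrow> y \<in> U))"
  (is "_ \<longleftrightarrow> ?R")
proof
  assume U: "openin perm_topology U"
  then obtain W where W: "openin (pointwise_topology X) W" "U = W \<inter> C"
    by (auto simp: openin_subtopology)
  show ?R
  proof (intro conjI ballI)
    show "U \<subseteq> C" using W by blast
    fix x assume "x \<in> U"
    then obtain F where "finite F" "F \<subseteq> X" "pointwise_nbhd X x F \<subseteq> W"
      using openin_pointwise_imp_nbhd[OF W(1)] W(2) by blast
    then show "\<exists>F. finite F \<and> F \<subseteq> X \<and> (\<forall>y\<in>C. (\<forall>c\<in>F. y c = x c) \<longrightarrow> y \<in> U)"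
      using W(2) carrier_subset unfolding pointwise_nbhd_def by (intro exI[of _ F]) blast
  qed
next
  assume R: ?R
  show "openin perm_topology U"
  proof (subst openin_subopen, intro ballI)
    fix x assume x: "x \<in> U"
    then obtain F where F: "finite F" "F \<subseteq> X" "\<forall>y\<in>C. (\<forall>c\<in>F. y c = x c) \<longrightarrow> y \<in> U" using R by blast
    have xC: "x \<in> C" "x \<in> Bij X" using R x carrier_subset by auto
    have "openin perm_topology (C \<inter> pointwise_nbhd X x F)"
      using openin_pointwise_nbhd[OF xC(2) F(2,1)] by (rule openin_subtopology_Int2)
    moreover have "C \<inter> pointwise_nbhd X x F \<subseteq> U" using F(3) unfolding pointwise_nbhd_def by blast
    ultimately show "\<exists>W. openin perm_topology W \<and> x \<in> W \<and> W \<subseteq> U"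
      using xC pointwise_nbhd_self by blast
  qed
qed

lemma open_subgroup_coset:
  assumes W: "subgroup W perm_group" "openin perm_topology W" and u: "u \<in> C"
  shows "openin perm_topology (W #>\<^bsub>perm_group\<^esub> u)"
  unfolding openin_perm_topology_iff
proof (intro conjI ballI)
  have WC: "W \<subseteq> C" using subgroup.subset[OF W(1)] by simp
  show "W #>\<^bsub>perm_group\<^esub> u \<subseteq> C" using perm.r_coset_subset_G[of W u] WC u by simp
  obtain F where F: "finite F" "F \<subseteq> X" "\<forall>y\<in>C. (\<forall>c\<in>F. y c = \<one>\<^bsub>perm_group\<^esub> c) \<longrightarrow> y \<in> W"
    using W(2) subgroup.one_closed[OF W(1)] unfolding openin_perm_topology_iff by blast
  fix y assume "y \<in> W #>\<^bsub>perm_group\<^esub> u"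
  then obtain w where w: "w \<in> W" "y = w \<otimes>\<^bsub>perm_group\<^esub> u" by (auto simp: r_coset_def)
  have y: "y \<in> C" "inv\<^bsub>perm_group\<^esub> y \<in> C" using w WC u mult_perm_closed inv_perm_closed by auto
  show "\<exists>F. finite F \<and> F \<subseteq> X \<and> (\<forall>z\<in>C. (\<forall>c\<in>F. z c = y c) \<longrightarrow> z \<in> W #>\<^bsub>perm_group\<^esub> u)"
  proof (intro exI conjI ballI impI)
    let ?F = "(inv\<^bsub>perm_group\<^esub> y) ` F"
    show "finite ?F" using F by simp
    show "?F \<subseteq> X" using F y perm_closed by blast
    fix z assume z: "z \<in> C" "\<forall>c\<in>?F. z c = y c"
    let ?v = "z \<otimes>\<^bsub>perm_group\<^esub> inv\<^bsub>perm_group\<^esub> y"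
    have vC: "?v \<in> C" using z y mult_perm_closed by simp
    have "?v c = \<one>\<^bsub>perm_group\<^esub> c" if "c \<in> F" for c
    proof -
      have c: "c \<in> X" using that F by blast
      have "?v c = z ((inv\<^bsub>perm_group\<^esub> y) c)" by (rule mult_app[OF z(1) y(2) c])
      also have "\<dots> = y ((inv\<^bsub>perm_group\<^esub> y) c)" using z(2) that by blast
      also have "\<dots> = c" by (rule inv_app(2)[OF y(1) c])
      finally show ?thesis using one_app[OF c] by simp
    qed
    then have "?v \<in> W" using F(3) vC by blast
    then have "?v \<otimes>\<^bsub>perm_group\<^esub> w \<in> W" using w subgroup.m_closed[OF W(1)] by blast
    moreover have "z = (?v \<otimes>\<^bsub>perm_group\<^esub> w) \<otimes>\<^bsub>perm_group\<^esub> u"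
    proof -
      have "(?v \<otimes>\<^bsub>perm_group\<^esub> w) \<otimes>\<^bsub>perm_group\<^esub> u = ?v \<otimes>\<^bsub>perm_group\<^esub> y"
        using perm.m_assoc[of ?v w u] vC w WC u by auto
      also have "\<dots> = z \<otimes>\<^bsub>perm_group\<^esub> (inv\<^bsub>perm_group\<^esub> y \<otimes>\<^bsub>perm_group\<^esub> y)"
        using perm.m_assoc[of z "inv\<^bsub>perm_group\<^esub> y" y] z y by simp
      also have "\<dots> = z" using perm.l_inv[of y] perm.r_one[of z] z y by simp
      finally show ?thesis by simp
    qed
    ultimately show "z \<in> W #>\<^bsub>perm_group\<^esub> u" unfolding r_coset_def by blast
  qed
qed

text \<open>The cosets of \<open>W\<close> that meet \<open>U\<close> are an open cover of \<open>U\<close> by pairwise disjoint sets, so finitely many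
  of them exhaust all.\<close>

lemma finite_cosets_of_compact_open:
  assumes U: "compact_open_subgroup perm_group perm_topology U"
    and W: "compact_open_subgroup perm_group perm_topology W"
  shows "finite (rel_cosets perm_group U W)"
proof -
  have s: "subgroup U perm_group" "subgroup W perm_group" "openin perm_topology W" "compactin perm_topology U"
    using assms by (auto simp: compact_open_subgroup_def)
  have UC: "U \<subseteq> C" using subgroup.subset[OF s(1)] by simp
  have self: "u \<in> W #>\<^bsub>perm_group\<^esub> u" if "u \<in> U" for u
    using perm.rcos_self[OF _ s(2), of u] that UC by auto
  have "\<forall>V\<in>rel_cosets perm_group U W. openin perm_topology V"
    unfolding rel_cosets_def using open_subgroup_coset[OF s(2,3)] UC by auto
  moreover have "U \<subseteq> \<Union>(rel_cosets perm_group U W)"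
    using self unfolding rel_cosets_def by auto
  ultimately obtain E where E: "finite E" "E \<subseteq> rel_cosets perm_group U W" "U \<subseteq> \<Union>E"
    using s(4) unfolding compactin_def by meson
  have "rel_cosets perm_group U W \<subseteq> E"
  proof
    fix V assume "V \<in> rel_cosets perm_group U W"
    then obtain u where u: "u \<in> U" "V = W #>\<^bsub>perm_group\<^esub> u" unfolding rel_cosets_def by auto
    then obtain u' where u': "u' \<in> U" "W #>\<^bsub>perm_group\<^esub> u' \<in> E" "u \<in> W #>\<^bsub>perm_group\<^esub> u'"
    proof -
      obtain D where D: "D \<in> E" "u \<in> D" using E(3) u(1) by blast
      then show thesis using that E(2) unfolding rel_cosets_def by auto
    qed
    then have "W #>\<^bsub>perm_group\<^esub> u' = V"
      using perm.repr_independence[OF u'(3) _ s(2)] UC u(2) by auto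
    then show "V \<in> E" using u'(2) by simp
  qed
  then show ?thesis using E finite_subset by blast
qed

lemma continuous_conjugation:
  assumes x: "x \<in> C"
  shows "continuous_map perm_topology perm_topology
    (\<lambda>v. inv\<^bsub>perm_group\<^esub> x \<otimes>\<^bsub>perm_group\<^esub> v \<otimes>\<^bsub>perm_group\<^esub> x)" (is "continuous_map _ _ ?f")
  unfolding continuous_map_def topspace_perm_topology
proof (intro conjI allI impI)
  have fC: "?f v \<in> C" if "v \<in> C" for v using that x by (intro mult_perm_closed inv_perm_closed)
  then show "?f \<in> C \<rightarrow> C" by blast
  fix U assume U: "openin perm_topology U"
  show "openin perm_topology {v \<in> C. ?f v \<in> U}"
    unfolding openin_perm_topology_iff
  proof (intro conjI ballI)
    fix v assume v: "v \<in> {v \<in> C. ?f v \<in> U}"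
    then obtain F where F: "finite F" "F \<subseteq> X" "\<forall>y\<in>C. (\<forall>c\<in>F. y c = ?f v c) \<longrightarrow> y \<in> U"
      using U unfolding openin_perm_topology_iff by blast
    have app: "?f w c = (inv\<^bsub>perm_group\<^esub> x) (w (x c))" if "w \<in> C" "c \<in> X" for w c
      using that x mult_app[of "inv\<^bsub>perm_group\<^esub> x \<otimes>\<^bsub>perm_group\<^esub> w" x c]
        mult_app[of "inv\<^bsub>perm_group\<^esub> x" w "x c"] mult_perm_closed inv_perm_closed perm_closed by metis
    show "\<exists>F. finite F \<and> F \<subseteq> X \<and> (\<forall>y\<in>C. (\<forall>c\<in>F. y c = v c) \<longrightarrow> y \<in> {v \<in> C. ?f v \<in> U})"
    proof (intro exI conjI ballI impI)
      show "finite (x ` F)" using F by simp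
      show "x ` F \<subseteq> X" using F x perm_closed by blast
      fix y assume y: "y \<in> C" "\<forall>c\<in>x ` F. y c = v c"
      have "?f y c = ?f v c" if "c \<in> F" for c
      proof -
        have "c \<in> X" "y (x c) = v (x c)" using that F(2) y(2) by auto
        then show ?thesis using app[OF y(1)] app[of v c] v by simp
      qed
      then show "y \<in> {v \<in> C. ?f v \<in> U}" using F(3) fC[OF y(1)] y(1) by blast
    qed
  qed blast
qed

lemma compact_open_conjugate:
  assumes U: "compact_open_subgroup perm_group perm_topology U" and x: "x \<in> C"
  shows "compact_open_subgroup perm_group perm_topology (conjugate perm_group x U)"
proof -
  have s: "subgroup U perm_group" "openin perm_topology U" "compactin perm_topology U"
    using U by (auto simp: compact_open_subgroup_def)
  have UC: "U \<subseteq> C" using subgroup.subset[OF s(1)] by simp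
  have xi: "inv\<^bsub>perm_group\<^esub> x \<in> C" using x by (rule inv_perm_closed)
  let ?g = "\<lambda>v. inv\<^bsub>perm_group\<^esub> (inv\<^bsub>perm_group\<^esub> x) \<otimes>\<^bsub>perm_group\<^esub> v \<otimes>\<^bsub>perm_group\<^esub> inv\<^bsub>perm_group\<^esub> x"
  have gf: "conjugate perm_group x (conjugate perm_group (inv\<^bsub>perm_group\<^esub> x) A) = A"
    "conjugate perm_group (inv\<^bsub>perm_group\<^esub> x) (conjugate perm_group x A) = A" if "A \<subseteq> C" for A
    using perm.conjugate_conjugate[of A "inv\<^bsub>perm_group\<^esub> x" x] perm.conjugate_conjugate[of A x "inv\<^bsub>perm_group\<^esub> x"]
      perm.conjugate_one[of A] that x xi perm.l_inv[of x] perm.r_inv[of x] by simp_all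
  have "conjugate perm_group x U = {v \<in> C. ?g v \<in> U}"
  proof (intro equalityI subsetI)
    fix v assume v: "v \<in> conjugate perm_group x U"
    then have "v \<in> C" using subgroup.subset[OF perm.conjugate_subgroup[OF s(1)]] x by auto
    moreover have "?g v \<in> conjugate perm_group (inv\<^bsub>perm_group\<^esub> x) (conjugate perm_group x U)"
      using v by (subst conjugate_def) blast
    ultimately show "v \<in> {v \<in> C. ?g v \<in> U}" using gf(2)[OF UC] by simp
  next
    fix v assume v: "v \<in> {v \<in> C. ?g v \<in> U}"
    then have "conjugate perm_group x {?g v} \<subseteq> conjugate perm_group x U" unfolding conjugate_def by blast
    moreover have "{?g v} = conjugate perm_group (inv\<^bsub>perm_group\<^esub> x) {v}" unfolding conjugate_def by simp
    ultimately show "v \<in> conjugate perm_group x U" using gf(1)[of "{v}"] v by simp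
  qed
  then have "openin perm_topology (conjugate perm_group x U)"
    using openin_continuous_map_preimage[OF continuous_conjugation[OF xi] s(2)]
    unfolding topspace_perm_topology by simp
  moreover have "compactin perm_topology (conjugate perm_group x U)"
    unfolding conjugate_def using image_compactin[OF s(3) continuous_conjugation[OF x]] .
  moreover have "subgroup (conjugate perm_group x U) perm_group"
    using perm.conjugate_subgroup[OF s(1)] x by simp
  ultimately show ?thesis by (simp add: compact_open_subgroup_def)
qed

text \<open>If \<open>L\<close> is covered by finitely many translates of \<open>L'\<close>, the closure of \<open>L\<close> is covered by the same
  translates of the closure of \<open>L'\<close>: finite sets that witness failure for each of the translates can be
  united into a single one.\<close>

lemma pointwise_closure_finite_cosets:
  assumes L: "L \<subseteq> (\<Union>r\<in>R. (\<lambda>l. r \<otimes>\<^bsub>perm_group\<^esub> l) ` L')" and R: "finite R" "R \<subseteq> C" and L': "L' \<subseteq> C"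
    and C: "pointwise_closure X L \<subseteq> C"
    and x: "x \<in> pointwise_closure X L"
  shows "\<exists>r\<in>R. inv\<^bsub>perm_group\<^esub> r \<otimes>\<^bsub>perm_group\<^esub> x \<in> pointwise_closure X L'"
proof (rule ccontr)
  assume neg: "\<not> ?thesis"
  have xC: "x \<in> C" using x C by blast
  have "\<exists>F. finite F \<and> F \<subseteq> X \<and> \<not> (\<exists>l\<in>L'. \<forall>c\<in>F. l c = (inv\<^bsub>perm_group\<^esub> r \<otimes>\<^bsub>perm_group\<^esub> x) c)"
    if "r \<in> R" for r
  proof -
    have "inv\<^bsub>perm_group\<^esub> r \<otimes>\<^bsub>perm_group\<^esub> x \<in> Bij X"
      using that R xC mult_perm_closed[of "inv\<^bsub>perm_group\<^esub> r" x] inv_perm_closed[of r] carrier_subset by auto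
    then show ?thesis using neg that unfolding pointwise_closure_def by auto
  qed
  then obtain F where F: "\<And>r. r \<in> R \<Longrightarrow> finite (F r) \<and> F r \<subseteq> X
      \<and> \<not> (\<exists>l\<in>L'. \<forall>c\<in>F r. l c = (inv\<^bsub>perm_group\<^esub> r \<otimes>\<^bsub>perm_group\<^esub> x) c)" by metis
  have fin: "finite (\<Union>(F ` R))" and sub: "\<Union>(F ` R) \<subseteq> X" using F R by auto
  obtain l where l: "l \<in> L" "\<forall>c\<in>\<Union>(F ` R). l c = x c"
    using pointwise_closureD[OF x fin sub] by blast
  obtain r l' where r: "r \<in> R" "l' \<in> L'" "l = r \<otimes>\<^bsub>perm_group\<^esub> l'" using l(1) L by auto
  have "l' c = (inv\<^bsub>perm_group\<^esub> r \<otimes>\<^bsub>perm_group\<^esub> x) c" if "c \<in> F r" for c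
  proof -
    have c: "c \<in> X" using that F[OF r(1)] by blast
    have rl: "r \<in> C" "l' \<in> C" using r R L' by auto
    have "r (l' c) = x c" using l(2) that r(1,3) mult_app[OF rl c] by auto
    then have "l' c = (inv\<^bsub>perm_group\<^esub> r) (x c)"
      using inv_app(1)[OF rl(1) perm_closed[OF rl(2) c]] by simp
    then show ?thesis using mult_app[OF inv_perm_closed[OF rl(1)] xC c] by simp
  qed
  then show False using F[OF r(1)] r(2) by blast
qed

text \<open>The closure of \<open>L'\<close> is closed and its finitely many translates cover the open group that is the
  closure of \<open>L\<close>, so it is open. In terms of points: a finite set separates the closure of \<open>L'\<close> from the
  finitely many representatives outside it.\<close>

lemma open_pointwise_closure_finite_cosets:
  assumes L: "L \<subseteq> (\<Union>r\<in>R. (\<lambda>l. r \<otimes>\<^bsub>perm_group\<^esub> l) ` L')" and R: "finite R" "R \<subseteq> C"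
    and L': "subgroup L' (BijGroup X)" "L' \<subseteq> L"
    and C: "pointwise_closure X L \<subseteq> C"
    and op: "openin perm_topology (pointwise_closure X L)"
  shows "openin perm_topology (pointwise_closure X L')"
proof -
  let ?K = "pointwise_closure X L'"
  have K: "subgroup ?K (BijGroup X)" using subgroup_pointwise_closure[OF L'(1)] .
  have KC: "?K \<subseteq> C" using pointwise_closure_mono[OF L'(2)] C by blast
  have L'C: "L' \<subseteq> C"
    using subset_pointwise_closure[of L' X] subgroup.subset[OF L'(1)] KC by (simp add: carrier_BijGroup)
  have Kinv: "inv\<^bsub>perm_group\<^esub> u \<in> ?K" if "u \<in> ?K" for u
    using subgroup.m_inv_closed[OF K that] inv_perm that KC by auto
  have Kmul: "u \<otimes>\<^bsub>perm_group\<^esub> v \<in> ?K" if "u \<in> ?K" "v \<in> ?K" for u v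
    using subgroup.m_closed[OF K that] by simp
  have "\<exists>F. finite F \<and> F \<subseteq> X \<and> (inv\<^bsub>perm_group\<^esub> r \<in> ?K \<or> \<not> (\<exists>l\<in>L'. \<forall>c\<in>F. l c = (inv\<^bsub>perm_group\<^esub> r) c))"
    if "r \<in> R" for r
  proof -
    have "inv\<^bsub>perm_group\<^esub> r \<in> Bij X" using that R inv_perm_closed[of r] carrier_subset by auto
    then show ?thesis unfolding pointwise_closure_def by (cases "inv\<^bsub>perm_group\<^esub> r \<in> ?K") (auto simp: pointwise_closure_def)
  qed
  then obtain F where F: "\<And>r. r \<in> R \<Longrightarrow> finite (F r) \<and> F r \<subseteq> X
      \<and> (inv\<^bsub>perm_group\<^esub> r \<in> ?K \<or> \<not> (\<exists>l\<in>L'. \<forall>c\<in>F r. l c = (inv\<^bsub>perm_group\<^esub> r) c))" by metis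
  let ?F = "\<Union>(F ` R)"
  have fin: "finite ?F" and sub: "?F \<subseteq> X" using F R by auto
  \<comment> \<open>It suffices to find a neighbourhood of the identity; translation by \<open>y\<close> does the rest.\<close>
  have near_one: "x \<in> ?K" if x: "x \<in> pointwise_closure X L" "\<forall>c\<in>?F. x c = c" for x
  proof -
    have xC: "x \<in> C" using x C by blast
    obtain r where r: "r \<in> R" "inv\<^bsub>perm_group\<^esub> r \<otimes>\<^bsub>perm_group\<^esub> x \<in> ?K"
      using pointwise_closure_finite_cosets[OF L R L'C C x(1)] by blast
    have rC: "r \<in> C" "inv\<^bsub>perm_group\<^esub> r \<in> C" using r R inv_perm_closed by auto
    have Fr: "finite (F r)" "F r \<subseteq> X" using F[OF r(1)] by auto
    obtain l where l: "l \<in> L'" "\<forall>c\<in>F r. l c = (inv\<^bsub>perm_group\<^esub> r \<otimes>\<^bsub>perm_group\<^esub> x) c"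
      using pointwise_closureD[OF r(2) Fr] by blast
    have "l c = (inv\<^bsub>perm_group\<^esub> r) c" if "c \<in> F r" for c
    proof -
      have c: "c \<in> X" using that Fr by blast
      have "x c = c" using x(2) r(1) that by blast
      then show ?thesis using l(2) that mult_app[OF rC(2) xC c] by simp
    qed
    then have "inv\<^bsub>perm_group\<^esub> r \<in> ?K" using F[OF r(1)] l(1) by blast
    then have "inv\<^bsub>perm_group\<^esub> (inv\<^bsub>perm_group\<^esub> r) \<otimes>\<^bsub>perm_group\<^esub> (inv\<^bsub>perm_group\<^esub> r \<otimes>\<^bsub>perm_group\<^esub> x) \<in> ?K"
      using Kmul Kinv r(2) by blast
    moreover have "inv\<^bsub>perm_group\<^esub> (inv\<^bsub>perm_group\<^esub> r) = r" using perm.inv_inv rC by simp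
    moreover have "r \<otimes>\<^bsub>perm_group\<^esub> (inv\<^bsub>perm_group\<^esub> r \<otimes>\<^bsub>perm_group\<^esub> x) = x"
      using perm.m_assoc[of r "inv\<^bsub>perm_group\<^esub> r" x] perm.r_inv[of r] perm.l_one[of x] rC xC by simp
    ultimately show ?thesis by simp
  qed
  show ?thesis unfolding openin_perm_topology_iff
  proof (intro conjI ballI)
    show "?K \<subseteq> C" by (rule KC)
    fix y assume y: "y \<in> ?K"
    then have yL: "y \<in> pointwise_closure X L" using pointwise_closure_mono[OF L'(2)] by blast
    have yC: "y \<in> C" "inv\<^bsub>perm_group\<^esub> y \<in> C" using y KC inv_perm_closed by auto
    obtain F0 where F0: "finite F0" "F0 \<subseteq> X"
      "\<forall>z\<in>C. (\<forall>c\<in>F0. z c = \<one>\<^bsub>perm_group\<^esub> c) \<longrightarrow> z \<in> pointwise_closure X L"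
    proof -
      have "\<one>\<^bsub>perm_group\<^esub> \<in> pointwise_closure X L"
        using subgroup.one_closed[OF K] pointwise_closure_mono[OF L'(2), of X] by auto
      then show thesis using op that unfolding openin_perm_topology_iff by blast
    qed
    show "\<exists>F. finite F \<and> F \<subseteq> X \<and> (\<forall>z\<in>C. (\<forall>c\<in>F. z c = y c) \<longrightarrow> z \<in> ?K)"
    proof (intro exI conjI ballI impI)
      show "finite (F0 \<union> ?F)" "F0 \<union> ?F \<subseteq> X" using F0 fin sub by auto
      fix z assume z: "z \<in> C" "\<forall>c\<in>F0 \<union> ?F. z c = y c"
      let ?v = "inv\<^bsub>perm_group\<^esub> y \<otimes>\<^bsub>perm_group\<^esub> z"
      have vC: "?v \<in> C" using z yC mult_perm_closed by blast
      have v: "?v c = c" if "c \<in> F0 \<union> ?F" for c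
      proof -
        have c: "c \<in> X" using that F0 sub by blast
        show ?thesis using mult_app[OF yC(2) z(1) c] z(2) that inv_app(1)[OF yC(1) c] by simp
      qed
      have "\<forall>c\<in>F0. ?v c = \<one>\<^bsub>perm_group\<^esub> c" using v one_app F0(2) by (simp add: subset_iff)
      then have "?v \<in> pointwise_closure X L" using F0(3) vC by blast
      then have "?v \<in> ?K" using near_one v by blast
      then have "y \<otimes>\<^bsub>perm_group\<^esub> ?v \<in> ?K" using Kmul y by blast
      moreover have "y \<otimes>\<^bsub>perm_group\<^esub> ?v = z"
        using perm.m_assoc[of y "inv\<^bsub>perm_group\<^esub> y" z] perm.r_inv[of y] perm.l_one[of z] yC z by simp
      ultimately show "z \<in> ?K" by simp
    qed
  qed
qed

end

section \<open>Groups with the Baumslag--Solitar relation\<close>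

text \<open>The last assumption records what the argument needs to know about a group generated by \<open>a\<close> and \<open>t\<close>
  beyond the defining relation. It bounds from below how far conjugation by \<open>t\<close> moves powers of \<open>a\<close>, and it also
  contains the fact that \<open>a\<close> has infinite order (\<open>k = 0\<close>).\<close>

locale baumslag_solitar = group G for G (structure) +
  fixes a t :: 'a and m n :: int
  assumes a_closed: "a \<in> carrier G" and t_closed: "t \<in> carrier G"
    and generated: "carrier G = generate G {a, t}"
    and m_nonzero: "m \<noteq> 0" and n_nonzero: "n \<noteq> 0"
    and relator: "t \<otimes> a [^] m \<otimes> inv t = a [^] n"
    and separation: "\<And>(k::nat) (i::int) (l::int).
      t [^] k \<otimes> a [^] i \<otimes> inv (t [^] k) = a [^] l \<Longrightarrow> i * n ^ k = l * m ^ k"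
begin

abbreviation ap :: "int \<Rightarrow> 'a" where "ap k \<equiv> a [^] k"

lemma conj_pow_mult:
  assumes g: "g \<in> carrier G" and e: "g \<otimes> ap (N::int) \<otimes> inv g = ap (N'::int)"
  shows "g \<otimes> ap (N * k) \<otimes> inv g = ap (N' * (k::int))"
proof -
  let ?c = "\<lambda>x. g \<otimes> x \<otimes> inv g"
  have hom: "?c \<in> hom G G"
  proof (rule homI)
    fix x y assume xy: "x \<in> carrier G" "y \<in> carrier G"
    have "inv g \<otimes> (g \<otimes> (y \<otimes> inv g)) = y \<otimes> inv g" using xy g by (simp add: m_assoc[symmetric])
    then show "?c (x \<otimes> y) = ?c x \<otimes> ?c y" using xy g by (simp add: m_assoc)
  qed (use g in simp)
  have "?c ((ap N) [^] k) = (?c (ap N)) [^] k"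
    using hom_int_pow[OF hom _ is_group is_group] a_closed by simp
  then show ?thesis using e a_closed by (simp add: int_pow_pow)
qed

lemma conj_pow_inv:
  assumes g: "g \<in> carrier G" and e: "g \<otimes> ap (N::int) \<otimes> inv g = ap (N'::int)"
  shows "inv g \<otimes> ap N' \<otimes> inv (inv g) = ap N"
proof -
  have "inv g \<otimes> (g \<otimes> (ap N \<otimes> (inv g \<otimes> g))) = ap N"
    using g a_closed by (simp add: m_assoc[symmetric])
  then show ?thesis unfolding e[symmetric] using g a_closed by (simp add: m_assoc)
qed

lemma conj_pow_trans:
  assumes g: "g \<in> carrier G" "h \<in> carrier G"
    and e: "g \<otimes> ap (N::int) \<otimes> inv g = ap (N'::int)" "h \<otimes> ap (M::int) \<otimes> inv h = ap N"
  shows "(g \<otimes> h) \<otimes> ap M \<otimes> inv (g \<otimes> h) = ap N'"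
  unfolding e(1)[symmetric] e(2)[symmetric] using g a_closed by (simp add: m_assoc inv_mult_group)

lemma conj_a: "a \<otimes> ap (k::int) \<otimes> inv a = ap k"
proof -
  have "a \<otimes> ap k = ap k \<otimes> a"
    using int_pow_mult[OF a_closed, of 1 k] int_pow_mult[OF a_closed, of k 1] a_closed by (simp add: add.commute)
  then show ?thesis using a_closed by (simp add: m_assoc)
qed

text \<open>The elements with this property contain \<open>a\<close> and \<open>t\<close> and are closed under inverses and products: for a
  product take suitable multiples of the exponents.\<close>

lemma commensurates_a:
  assumes "g \<in> carrier G"
  shows "\<exists>N N'. N \<noteq> 0 \<and> N' \<noteq> 0 \<and> g \<otimes> ap N \<otimes> inv g = ap N'"
proof -
  have "g \<in> generate G {a, t}" using assms generated by simp
  then show ?thesis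
  proof (induction rule: generate.induct)
    case one
    show ?case using a_closed by (intro exI[of _ 1]) simp
  next
    case (incl h)
    then consider "h = a" | "h = t" by blast
    then show ?case
    proof cases
      case 1
      then show ?thesis using conj_a[of 1] by (intro exI[of _ 1]) simp
    next
      case 2
      then show ?thesis using relator m_nonzero n_nonzero by (intro exI[of _ m] exI[of _ n]) simp
    qed
  next
    case (inv h)
    then consider "h = a" | "h = t" by blast
    then show ?case
    proof cases
      case 1
      then show ?thesis using conj_pow_inv[OF a_closed conj_a, of 1] by (intro exI[of _ 1]) simp
    next
      case 2
      then show ?thesis using conj_pow_inv[OF t_closed relator] m_nonzero n_nonzero
        by (intro exI[of _ n] exI[of _ m]) simp
    qed
  next
    case (eng g h)
    have gh: "g \<in> carrier G" "h \<in> carrier G" using eng generated by simp_all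
    obtain N N' where N: "N \<noteq> 0" "N' \<noteq> 0" "g \<otimes> ap (N::int) \<otimes> inv g = ap (N'::int)"
      using eng.IH(1) by blast
    obtain M M' where M: "M \<noteq> 0" "M' \<noteq> 0" "h \<otimes> ap (M::int) \<otimes> inv h = ap (M'::int)"
      using eng.IH(2) by blast
    have "(g \<otimes> h) \<otimes> ap (M * N) \<otimes> inv (g \<otimes> h) = ap (N' * M')"
      using conj_pow_trans[OF gh conj_pow_mult[OF gh(1) N(3), of M']] conj_pow_mult[OF gh(2) M(3), of N]
      by (simp add: mult.commute)
    then show ?case using N M by (metis mult_eq_0_iff)
  qed
qed

abbreviation H where "H \<equiv> generate G {a}"

definition X where "X = lcosets H"

definition act where "act = coset_action G H"

lemma H_eq: "H = {ap k | k::int. True}"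
  using generate_pow[OF a_closed] by simp

lemma subgroup_H: "subgroup H G"
  by (rule generate_is_subgroup) (simp add: a_closed)

lemma H_subset: "H \<subseteq> carrier G"
  using subgroup.subset[OF subgroup_H] .

lemma X_eq: "X = {g <# H | g. g \<in> carrier G}"
  unfolding X_def LCOSETS_def by auto

lemma H_in_X: "H \<in> X"
  unfolding X_eq using lcos_mult_one[OF H_subset] by force

lemma l_coset_X: "g \<in> carrier G \<Longrightarrow> c \<in> X \<Longrightarrow> g <# c \<in> X"
  unfolding X_eq using lcos_m_assoc[OF H_subset] by auto

lemma l_coset_mult_X:
  "\<lbrakk>g \<in> carrier G; h \<in> carrier G; c \<in> X\<rbrakk> \<Longrightarrow> g <# (h <# c) = (g \<otimes> h) <# c"
  unfolding X_eq using lcos_m_assoc[OF l_coset_subset_G[OF H_subset]] by auto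

lemma l_coset_one_X: "c \<in> X \<Longrightarrow> \<one> <# c = c"
  unfolding X_eq using lcos_mult_one[OF l_coset_subset_G[OF H_subset]] by auto

lemma act_app: "c \<in> X \<Longrightarrow> act g c = g <# c"
  unfolding act_def coset_action_def X_def by simp

lemma act_Bij: "g \<in> carrier G \<Longrightarrow> act g \<in> Bij X"
proof -
  assume g: "g \<in> carrier G"
  have "bij_betw (act g) X X"
  proof (rule bij_betw_byWitness[where f' = "act (inv g)"])
    show "\<forall>c\<in>X. act (inv g) (act g c) = c" "\<forall>c\<in>X. act g (act (inv g) c) = c"
      using g by (simp_all add: act_app l_coset_X l_coset_mult_X l_coset_one_X)
    show "act g ` X \<subseteq> X" "act (inv g) ` X \<subseteq> X"
      using g by (auto simp add: act_app l_coset_X)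
  qed
  moreover have "act g \<in> extensional X" unfolding act_def coset_action_def X_def by simp
  ultimately show ?thesis unfolding Bij_def by simp
qed

lemma act_mult: "g \<in> carrier G \<Longrightarrow> h \<in> carrier G \<Longrightarrow> act (g \<otimes> h) = act g \<otimes>\<^bsub>BijGroup X\<^esub> act h"
proof (rule Bij_eqI[of _ X])
  assume gh: "g \<in> carrier G" "h \<in> carrier G"
  show "act (g \<otimes> h) \<in> Bij X" using gh act_Bij by simp
  show "act g \<otimes>\<^bsub>BijGroup X\<^esub> act h \<in> Bij X"
    using gh act_Bij group.is_monoid[OF group_BijGroup, of X] monoid.m_closed carrier_BijGroup by metis
  fix c assume "c \<in> X"
  then show "act (g \<otimes> h) c = (act g \<otimes>\<^bsub>BijGroup X\<^esub> act h) c"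
    using gh by (simp add: act_app act_Bij BijGroup_mult_app l_coset_X l_coset_mult_X)
qed

lemma act_hom: "act \<in> hom G (BijGroup X)"
  by (rule homI) (simp_all add: carrier_BijGroup act_Bij act_mult)

lemma act_group_hom: "group_hom G (BijGroup X) act"
  using act_hom is_group group_BijGroup by (simp add: group_hom_def group_hom_axioms_def)

definition C where "C = pointwise_closure X (act ` carrier G)"

lemma subgroup_image: "subgroup (act ` carrier G) (BijGroup X)"
  using group_hom.img_is_subgroup[OF act_group_hom] .

sublocale permutation_subgroup X C
  by (rule permutation_subgroup.intro) (simp add: C_def subgroup_image subgroup_pointwise_closure)

lemma act_in_C: "g \<in> carrier G \<Longrightarrow> act g \<in> C"
  unfolding C_def using subset_pointwise_closure[of "act ` carrier G" X] act_Bij by blast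

lemma act_mult_perm: "g \<in> carrier G \<Longrightarrow> h \<in> carrier G \<Longrightarrow> act (g \<otimes> h) = act g \<otimes>\<^bsub>perm_group\<^esub> act h"
  by (simp add: act_mult)

lemma act_inv_perm: "g \<in> carrier G \<Longrightarrow> act (inv g) = inv\<^bsub>perm_group\<^esub> (act g)"
  using group_hom.hom_inv[OF act_group_hom] inv_perm[OF act_in_C] by simp

definition cyc :: "int \<Rightarrow> _" where "cyc N = (\<lambda>k. act (ap (N * k))) ` UNIV"

text \<open>For \<open>N \<noteq> 0\<close> these are compact open subgroups, and small enough to read off conjugation by elements
  of \<open>G\<close> from conjugation of powers of \<open>a\<close>.\<close>

definition V where "V N = pointwise_closure X (cyc N)"

lemma subgroup_cyc: "subgroup (cyc N) (BijGroup X)"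
proof -
  have "cyc N = act ` generate G {ap N}"
    unfolding cyc_def generate_pow[OF int_pow_closed[OF a_closed]]
    by (auto simp: int_pow_pow a_closed)
  moreover have "subgroup (generate G {ap N}) G"
    by (rule generate_is_subgroup) (simp add: a_closed)
  ultimately show ?thesis
    using group_hom.subgroup_img_is_subgroup[OF act_group_hom] by simp
qed

lemma cyc_subset_image: "cyc N \<subseteq> act ` carrier G"
  unfolding cyc_def using a_closed by auto

lemma cyc_subset_C: "cyc N \<subseteq> C"
  unfolding cyc_def using a_closed act_in_C by auto

lemma cyc_mult_subset: "cyc (N * k) \<subseteq> cyc N"
  unfolding cyc_def by (auto simp: mult.assoc)

lemma V_subset_C: "V N \<subseteq> C"
  unfolding V_def C_def by (rule pointwise_closure_mono[OF cyc_subset_image])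

lemma V_mult_subset: "V (N * k) \<subseteq> V N"
  unfolding V_def by (rule pointwise_closure_mono[OF cyc_mult_subset])

lemma V_subset_V1: "V N \<subseteq> V 1"
  using V_mult_subset[of 1 N] by simp

lemma V_minus: "V (- N) = V N"
  using V_mult_subset[of N "-1"] V_mult_subset[of "-N" "-1"] by simp

lemma V_abs_cong: "\<bar>N\<bar> = \<bar>N'\<bar> \<Longrightarrow> V N = V N'"
  using V_minus by (auto simp: abs_eq_iff)

lemma act_pow_in_V: "act (ap (N * k)) \<in> V N"
  unfolding V_def using subset_pointwise_closure[of "cyc N" X] cyc_subset_C carrier_subset
  by (auto simp: cyc_def)

lemma subgroup_V: "subgroup (V N) perm_group"
  using group.subgroup_incl[OF group_BijGroup subgroup_pointwise_closure[OF subgroup_cyc] subgroup_Bij]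
    V_subset_C unfolding V_def by blast

lemma act_fixes_H_iff: "g \<in> carrier G \<Longrightarrow> act g H = H \<longleftrightarrow> g \<in> H"
  using act_app[OF H_in_X] lcos_self[OF _ subgroup_H, of g] coset_join3[OF _ subgroup_H, of g] by auto

text \<open>The stabilizer of the base coset is open, so it is the closure of its intersection with the dense
  image of \<open>G\<close>, and the elements of \<open>G\<close> that fix the base coset are the powers of \<open>a\<close>.\<close>

lemma V1_eq_stabilizer: "V 1 = {v \<in> C. v H = H}"
proof (rule subset_antisym; rule subsetI)
  fix v assume v: "v \<in> V 1"
  then have "v \<in> C" using V_subset_C by blast
  obtain k where "act (ap (1 * k)) H = v H"
    using pointwise_closureD[OF v[unfolded V_def], of "{H}"] H_in_X unfolding cyc_def by auto
  moreover have "ap (1 * k) \<in> H" unfolding H_eq by auto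
  ultimately have "v H = H" using act_fixes_H_iff[of "ap (1 * k)"] H_subset by auto
  with \<open>v \<in> C\<close> show "v \<in> {v \<in> C. v H = H}" by simp
next
  fix v assume "v \<in> {v \<in> C. v H = H}"
  then have v: "v \<in> C" "v H = H" by auto
  have "\<exists>s\<in>cyc 1. \<forall>c\<in>F. s c = v c" if F: "finite F" "F \<subseteq> X" for F
  proof -
    have "finite (insert H F)" "insert H F \<subseteq> X" using F H_in_X by auto
    then obtain g where g: "g \<in> carrier G" "\<forall>c\<in>insert H F. act g c = v c"
      using pointwise_closureD[OF v(1)[unfolded C_def], of "insert H F"] by blast
    then have "g \<in> H" using act_fixes_H_iff v by simp
    then have "act g \<in> cyc 1" unfolding H_eq cyc_def by auto
    then show ?thesis using g by blast
  qed
  then show "v \<in> V 1" unfolding V_def pointwise_closure_def using v(1) carrier_subset by auto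
qed

text \<open>Since \<open>g\<close> commensurates \<open>\<langle>a\<rangle>\<close>, some nontrivial power of \<open>a\<close> fixes the coset of \<open>g\<close>. This is where local
  compactness of the closure comes from.\<close>

lemma finite_a_orbits:
  assumes "c \<in> X"
  shows "finite ((\<lambda>l. l c) ` cyc 1)"
proof -
  obtain g where g: "g \<in> carrier G" "c = g <# H" using assms unfolding X_eq by blast
  obtain N N' where N: "N' \<noteq> 0" "inv g \<otimes> ap (N::int) \<otimes> inv (inv g) = ap (N'::int)" "N \<noteq> 0"
    using commensurates_a[of "inv g"] g by auto
  have fix_c: "ap (N * k) <# c = c" for k
  proof -
    have e: "g \<otimes> ap (N' * k) \<otimes> inv g = ap (N * k)"
      using conj_pow_mult[OF g(1), of N' N k] conj_pow_inv[of "inv g" N N'] N g by simp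
    have "ap (N * k) \<otimes> g = g \<otimes> ap (N' * k)"
      unfolding e[symmetric] using g a_closed by (simp add: m_assoc)
    moreover have "ap (N' * k) <# H = H"
      by (rule coset_join3[OF _ subgroup_H]) (auto simp: H_eq a_closed)
    ultimately show ?thesis
      unfolding g(2) using lcos_m_assoc[OF H_subset] g(1) a_closed int_pow_closed by metis
  qed
  have "act (ap k) c = act (ap (k mod \<bar>N\<bar>)) c" for k
  proof -
    have "k = k mod \<bar>N\<bar> + N * (sgn N * (k div \<bar>N\<bar>))"
      using mod_mult_div_eq[of k "\<bar>N\<bar>"] by (simp add: mult.assoc[symmetric] abs_sgn)
    then have "ap k = ap (k mod \<bar>N\<bar>) \<otimes> ap (N * (sgn N * (k div \<bar>N\<bar>)))"
      using int_pow_mult[OF a_closed] by metis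
    then show ?thesis
      using act_app[OF assms] l_coset_mult_X[OF _ _ assms] fix_c a_closed int_pow_closed by metis
  qed
  moreover have "k mod \<bar>N\<bar> \<in> {0..<\<bar>N\<bar>}" for k using N(3) by simp
  ultimately have "act (ap k) c \<in> (\<lambda>i. act (ap i) c) ` {0..<\<bar>N\<bar>}" for k
    by (metis imageI)
  then have "(\<lambda>l. l c) ` cyc 1 \<subseteq> (\<lambda>i. act (ap i) c) ` {0..<\<bar>N\<bar>}"
    unfolding cyc_def by auto
  then show ?thesis using finite_surj by blast
qed

lemma compact_open_V1: "compact_open_subgroup perm_group perm_topology (V 1)"
proof -
  have "openin perm_topology (V 1)" unfolding openin_perm_topology_iff
  proof (intro conjI ballI)
    show "V 1 \<subseteq> C" by (rule V_subset_C)
    fix v assume "v \<in> V 1"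
    then show "\<exists>F. finite F \<and> F \<subseteq> X \<and> (\<forall>y\<in>C. (\<forall>c\<in>F. y c = v c) \<longrightarrow> y \<in> V 1)"
      unfolding V1_eq_stabilizer using H_in_X by (intro exI[of _ "{H}"]) auto
  qed
  moreover have "compactin (pointwise_topology X) (V 1)"
    unfolding V_def
  proof (rule compactin_pointwise_closure)
    show "cyc 1 \<subseteq> Bij X" using cyc_subset_C carrier_subset by blast
    show "finite ((\<lambda>l. l c) ` cyc 1)" if "c \<in> X" for c by (rule finite_a_orbits[OF that])
    show "c \<in> (\<lambda>l. l c) ` cyc 1" if "c \<in> X" for c
      using imageI[OF subgroup.one_closed[OF subgroup_cyc[of 1]], of "\<lambda>l. l c"] BijGroup_one_app[OF that] by simp
    fix l c d assume lcd: "l \<in> cyc 1" "c \<in> X" "d \<in> (\<lambda>l. l c) ` cyc 1"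
    then obtain l' where l': "l' \<in> cyc 1" "d = l' c" by blast
    have "(l \<otimes>\<^bsub>BijGroup X\<^esub> l') c = l d"
      unfolding l'(2) using lcd l' cyc_subset_C carrier_subset by (intro BijGroup_mult_app) auto
    then show "l d \<in> (\<lambda>l. l c) ` cyc 1"
      using subgroup.m_closed[OF subgroup_cyc lcd(1) l'(1)] by (metis imageI)
  qed
  ultimately show ?thesis
    unfolding compact_open_subgroup_def using subgroup_V V_subset_C by (simp add: compactin_subtopology)
qed

lemma cyc_finite_cosets:
  assumes "k \<noteq> 0"
  shows "cyc N \<subseteq> (\<Union>r\<in>(\<lambda>i. act (ap (N * i))) ` {0..<\<bar>k\<bar>}. (\<lambda>l. r \<otimes>\<^bsub>perm_group\<^esub> l) ` cyc (N * k))"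
proof
  fix x assume "x \<in> cyc N"
  then obtain j where x: "x = act (ap (N * j))" unfolding cyc_def by blast
  have "j = j mod \<bar>k\<bar> + k * (sgn k * (j div \<bar>k\<bar>))"
    using mod_mult_div_eq[of j "\<bar>k\<bar>"] by (simp add: mult.assoc[symmetric] abs_sgn)
  then have "N * j = N * (j mod \<bar>k\<bar>) + N * k * (sgn k * (j div \<bar>k\<bar>))"
    by (metis mult.assoc distrib_left)
  then have "x = act (ap (N * (j mod \<bar>k\<bar>))) \<otimes>\<^bsub>perm_group\<^esub> act (ap (N * k * (sgn k * (j div \<bar>k\<bar>))))"
    unfolding x using int_pow_mult[OF a_closed] act_mult_perm a_closed int_pow_closed by metis
  moreover have "j mod \<bar>k\<bar> \<in> {0..<\<bar>k\<bar>}" using assms by simp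
  ultimately show "x \<in> (\<Union>r\<in>(\<lambda>i. act (ap (N * i))) ` {0..<\<bar>k\<bar>}. (\<lambda>l. r \<otimes>\<^bsub>perm_group\<^esub> l) ` cyc (N * k))"
    unfolding cyc_def[of "N * k"] by blast
qed

lemma compact_open_V:
  assumes "N \<noteq> 0"
  shows "compact_open_subgroup perm_group perm_topology (V N)"
proof -
  have V1: "openin perm_topology (V 1)" "compactin perm_topology (V 1)"
    using compact_open_V1 by (auto simp: compact_open_subgroup_def)
  have "(\<lambda>i. act (ap (1 * i))) ` {0..<\<bar>N\<bar>} \<subseteq> C" using a_closed act_in_C by auto
  then have "openin perm_topology (V N)"
    unfolding V_def
    using open_pointwise_closure_finite_cosets[OF cyc_finite_cosets[OF assms, of 1] _ _ _ _ _ V1(1)[unfolded V_def]]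
      subgroup_cyc cyc_mult_subset[of 1 N] V_subset_C[of 1] unfolding V_def by simp
  moreover have "compactin perm_topology (V N)"
  proof -
    have "cyc N \<subseteq> Bij X" using cyc_subset_C carrier_subset by blast
    then have "closedin (pointwise_topology X) (V N)"
      unfolding V_def using closure_of_pointwise_topology closedin_closure_of by metis
    then have "compactin (pointwise_topology X) (V N)"
      using V1(2) V_subset_V1 closed_compactin by (metis compactin_subtopology)
    then show ?thesis using V_subset_C by (simp add: compactin_subtopology)
  qed
  ultimately show ?thesis using subgroup_V by (simp add: compact_open_subgroup_def)
qed

sublocale perm: commensurated_group perm_group perm_topology
proof
  show "\<exists>U. compact_open_subgroup perm_group perm_topology U" using compact_open_V1 by blast
  show "compact_open_subgroup perm_group perm_topology (conjugate perm_group x U)"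
    if "compact_open_subgroup perm_group perm_topology U" "x \<in> carrier perm_group" for U x
    using compact_open_conjugate that by simp
qed (rule finite_cosets_of_compact_open)

text \<open>On any given finite set of cosets, elements of \<open>V 1\<close> agree with powers of \<open>a\<close>, and these commute.\<close>

lemma V1_commute:
  assumes "u \<in> V 1" "v \<in> V 1"
  shows "u \<otimes>\<^bsub>perm_group\<^esub> v = v \<otimes>\<^bsub>perm_group\<^esub> u"
proof (rule perm_eqI)
  have uvC: "u \<in> C" "v \<in> C" using assms V_subset_C by auto
  show "u \<otimes>\<^bsub>perm_group\<^esub> v \<in> C" "v \<otimes>\<^bsub>perm_group\<^esub> u \<in> C" using uvC mult_perm_closed by auto
  fix c assume c: "c \<in> X"
  have uc: "u c \<in> X" "v c \<in> X" using uvC c perm_closed by auto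
  obtain i where i: "act (ap (1 * i)) c = v c" "act (ap (1 * i)) (u c) = v (u c)"
    using pointwise_closureD[OF assms(2)[unfolded V_def], of "{c, u c}"] c uc unfolding cyc_def by auto
  obtain j where j: "act (ap (1 * j)) c = u c" "act (ap (1 * j)) (v c) = u (v c)"
    using pointwise_closureD[OF assms(1)[unfolded V_def], of "{c, v c}"] c uc unfolding cyc_def by auto
  have "ap i \<otimes> ap j = ap j \<otimes> ap i"
    using int_pow_mult[OF a_closed] by (metis add.commute)
  then have "ap j <# (ap i <# c) = ap i <# (ap j <# c)"
    using l_coset_mult_X c a_closed by simp
  then have "u (v c) = v (u c)" using i j act_app c uc by simp
  then show "(u \<otimes>\<^bsub>perm_group\<^esub> v) c = (v \<otimes>\<^bsub>perm_group\<^esub> u) c" using uvC c mult_app by simp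
qed

lemma V1_normalizes_V:
  assumes "v \<in> V 1"
  shows "conjugate perm_group v (V N) = V N"
proof -
  have vC: "v \<in> C" "inv\<^bsub>perm_group\<^esub> v \<in> C" using assms V_subset_C inv_perm_closed by auto
  have "inv\<^bsub>perm_group\<^esub> v \<otimes>\<^bsub>perm_group\<^esub> u \<otimes>\<^bsub>perm_group\<^esub> v = u" if "u \<in> V N" for u
  proof -
    have u: "u \<in> V 1" "u \<in> C" using that V_subset_V1 V_subset_C by auto
    have "inv\<^bsub>perm_group\<^esub> v \<otimes>\<^bsub>perm_group\<^esub> u \<otimes>\<^bsub>perm_group\<^esub> v
        = (inv\<^bsub>perm_group\<^esub> v \<otimes>\<^bsub>perm_group\<^esub> v) \<otimes>\<^bsub>perm_group\<^esub> u"
      using perm.m_assoc[of "inv\<^bsub>perm_group\<^esub> v"] V1_commute[OF u(1) assms] u vC by simp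
    then show ?thesis using perm.l_inv[of v] perm.l_one[of u] u vC by simp
  qed
  then show ?thesis unfolding conjugate_def by simp
qed

text \<open>The image of \<open>G\<close> is dense and the stabilizer \<open>V 1\<close> of the base coset is open.\<close>

lemma closure_factorization:
  assumes "x \<in> C"
  shows "\<exists>g\<in>carrier G. \<exists>v\<in>V 1. x = act g \<otimes>\<^bsub>perm_group\<^esub> v"
proof -
  obtain g where g: "g \<in> carrier G" "act g H = x H"
    using pointwise_closureD[OF assms[unfolded C_def], of "{H}"] H_in_X by auto
  let ?v = "inv\<^bsub>perm_group\<^esub> (act g) \<otimes>\<^bsub>perm_group\<^esub> x"
  have gC: "act g \<in> C" "inv\<^bsub>perm_group\<^esub> (act g) \<in> C" using act_in_C[OF g(1)] inv_perm_closed by auto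
  have "?v H = H"
    using mult_app[OF gC(2) assms H_in_X] g(2)[symmetric] inv_app(1)[OF gC(1) H_in_X] by simp
  then have "?v \<in> V 1" unfolding V1_eq_stabilizer using gC assms mult_perm_closed by blast
  moreover have "x = act g \<otimes>\<^bsub>perm_group\<^esub> ?v"
    using perm.m_assoc[of "act g" "inv\<^bsub>perm_group\<^esub> (act g)" x] perm.r_inv[of "act g"] perm.l_one[of x] gC assms
    by simp
  ultimately show ?thesis using g by blast
qed

text \<open>Conjugation is continuous, so it carries approximations by powers of \<open>ap N'\<close> to approximations by
  powers of \<open>ap N\<close>.\<close>

lemma conjugate_V_subset:
  assumes g: "g \<in> carrier G" and e: "g \<otimes> ap (N::int) \<otimes> inv g = ap (N'::int)"
  shows "conjugate perm_group (act g) (V N') \<subseteq> V N"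
proof
  fix w assume "w \<in> conjugate perm_group (act g) (V N')"
  then obtain v where v: "v \<in> V N'" "w = inv\<^bsub>perm_group\<^esub> (act g) \<otimes>\<^bsub>perm_group\<^esub> v \<otimes>\<^bsub>perm_group\<^esub> act g"
    unfolding conjugate_def by blast
  have C: "v \<in> C" "act g \<in> C" "act (inv g) \<in> C" using v V_subset_C act_in_C g by auto
  have w: "w = act (inv g) \<otimes>\<^bsub>perm_group\<^esub> v \<otimes>\<^bsub>perm_group\<^esub> act g" using v act_inv_perm[OF g] by simp
  have wC: "w \<in> C" unfolding w using C by (intro mult_perm_closed)
  have w_app: "w c = act (inv g) (v (act g c))" if "c \<in> X" for c
    unfolding w using that C mult_perm_closed perm_closed mult_app by metis
  have "\<exists>s\<in>cyc N. \<forall>c\<in>F. s c = w c" if F: "finite F" "F \<subseteq> X" for F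
  proof -
    have "finite (act g ` F)" "act g ` F \<subseteq> X" using F perm_closed[OF C(2)] by auto
    then obtain k where k: "\<forall>c\<in>act g ` F. act (ap (N' * k)) c = v c"
      using pointwise_closureD[OF v(1)[unfolded V_def], of "act g ` F"] unfolding cyc_def by blast
    have "act (ap (N * k)) c = w c" if "c \<in> F" for c
    proof -
      have c: "c \<in> X" using that F by blast
      have eq: "inv g \<otimes> ap (N' * k) \<otimes> g = ap (N * k)"
        using conj_pow_inv[OF g conj_pow_mult[OF g e, of k]] g by simp
      have "w c = act (inv g) (act (ap (N' * k)) (act g c))"
        using w_app[OF c] k that by simp
      also have "\<dots> = inv g \<otimes> ap (N' * k) \<otimes> g <# c"
        using c g a_closed by (simp add: act_app l_coset_X l_coset_mult_X m_assoc)
      finally show ?thesis using act_app[OF c] eq by simp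
    qed
    then show ?thesis unfolding cyc_def by blast
  qed
  then show "w \<in> V N" unfolding V_def pointwise_closure_def using wC carrier_subset by auto
qed

lemma conjugate_V:
  assumes g: "g \<in> carrier G" and e: "g \<otimes> ap (N::int) \<otimes> inv g = ap (N'::int)"
  shows "conjugate perm_group (act g) (V N') = V N"
proof
  show "conjugate perm_group (act g) (V N') \<subseteq> V N" by (rule conjugate_V_subset[OF assms])
  have C: "act g \<in> C" "inv\<^bsub>perm_group\<^esub> (act g) \<in> C" using act_in_C[OF g] inv_perm_closed by auto
  have "conjugate perm_group (inv\<^bsub>perm_group\<^esub> (act g)) (V N) \<subseteq> V N'"
    using conjugate_V_subset[OF inv_closed[OF g] conj_pow_inv[OF g e]] act_inv_perm[OF g] by simp
  then have "conjugate perm_group (act g) (conjugate perm_group (inv\<^bsub>perm_group\<^esub> (act g)) (V N))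
      \<subseteq> conjugate perm_group (act g) (V N')"
    by (auto simp: conjugate_def)
  moreover have "conjugate perm_group (act g) (conjugate perm_group (inv\<^bsub>perm_group\<^esub> (act g)) (V N)) = V N"
    using perm.conjugate_conjugate[of "V N" "inv\<^bsub>perm_group\<^esub> (act g)" "act g"]
      perm.conjugate_one[of "V N"] perm.l_inv[of "act g"] C V_subset_C by simp
  ultimately show "V N \<subseteq> conjugate perm_group (act g) (V N')" by simp
qed

end

section \<open>The modular function of the closure\<close>

text \<open>The Archimedean principle that turns bounds on indices up to a constant factor into exact values
  of the modular function.\<close>

lemma le_of_power_le_mult_power:
  fixes x y D :: real
  assumes "x > 0" "y > 0" and le: "\<And>k. x ^ k \<le> D * y ^ k"
  shows "x \<le> y"
proof (rule ccontr)
  assume "\<not> x \<le> y"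
  then have "1 < x / y" using assms by simp
  then obtain k where "D < (x / y) ^ k" using real_arch_pow by blast
  then have "D * y ^ k < x ^ k" using assms by (simp add: power_divide field_simps)
  then show False using le[of k] by simp
qed

context baumslag_solitar
begin

lemma conj_index_act:
  assumes "g \<in> carrier G" "N \<noteq> 0"
  shows "conj_index perm_group (act g) (V N) = rel_index perm_group (V N) (conjugate perm_group (act g) (V N))"
  using perm.conj_index_eq_rel_index[OF subgroup_V, of "act g"] act_in_C assms by simp

text \<open>The powers of \<open>ap N\<close> with exponents below \<open>\<bar>k\<bar>\<close> represent all cosets of \<open>V (N * k)\<close> in \<open>V N\<close>, and
  therefore all cosets of any larger group.\<close>

lemma conj_index_le:
  assumes g: "g \<in> carrier G" and N: "N \<noteq> 0" "k \<noteq> 0"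
    and sub: "V (N * k) \<subseteq> conjugate perm_group (act g) (V N)"
  shows "int (conj_index perm_group (act g) (V N)) \<le> \<bar>k\<bar>"
proof -
  let ?B = "conjugate perm_group (act g) (V N)"
  have sB: "subgroup ?B perm_group" using perm.conjugate_subgroup[OF subgroup_V] act_in_C g by simp
  have "rel_cosets perm_group (V N) ?B \<subseteq> (\<lambda>i. ?B #>\<^bsub>perm_group\<^esub> act (ap (N * i))) ` {0..<\<bar>k\<bar>}"
  proof
    fix D assume "D \<in> rel_cosets perm_group (V N) ?B"
    then obtain v where v: "v \<in> V N" "D = ?B #>\<^bsub>perm_group\<^esub> v" unfolding rel_cosets_def by blast
    have reps: "(\<lambda>i. act (ap (N * i))) ` {0..<\<bar>k\<bar>} \<subseteq> C" using a_closed act_in_C by auto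
    have VC: "pointwise_closure X (cyc N) \<subseteq> C" using V_subset_C unfolding V_def .
    obtain i where i: "i \<in> {0..<\<bar>k\<bar>}"
      "inv\<^bsub>perm_group\<^esub> (act (ap (N * i))) \<otimes>\<^bsub>perm_group\<^esub> v \<in> V (N * k)"
      using pointwise_closure_finite_cosets[OF cyc_finite_cosets[OF N(2)] _ reps cyc_subset_C VC v(1)[unfolded V_def]]
      unfolding V_def by auto
    define r w where "r = act (ap (N * i))" and "w = inv\<^bsub>perm_group\<^esub> r \<otimes>\<^bsub>perm_group\<^esub> v"
    have rV: "r \<in> V N" "r \<in> C" unfolding r_def using act_pow_in_V V_subset_C by auto
    have wV: "w \<in> V (N * k)" "w \<in> C" using i(2) V_subset_C unfolding w_def r_def by auto
    have vC: "v \<in> C" using v V_subset_C by auto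
    have "r \<otimes>\<^bsub>perm_group\<^esub> w = v"
      unfolding w_def
      using perm.m_assoc[of r "inv\<^bsub>perm_group\<^esub> r" v] perm.r_inv[of r] perm.l_one[of v] rV vC inv_perm_closed by simp
    then have "v = w \<otimes>\<^bsub>perm_group\<^esub> r" using V1_commute[of r w] rV(1) wV(1) V_subset_V1 by auto
    then have "D = ?B #>\<^bsub>perm_group\<^esub> w #>\<^bsub>perm_group\<^esub> r"
      using v(2) perm.coset_mult_assoc[of ?B w r] subgroup.subset[OF sB] wV rV by simp
    also have "?B #>\<^bsub>perm_group\<^esub> w = ?B"
      using perm.coset_join2[of w ?B] sB wV sub by auto
    finally show "D \<in> (\<lambda>i. ?B #>\<^bsub>perm_group\<^esub> act (ap (N * i))) ` {0..<\<bar>k\<bar>}"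
      using i(1) unfolding r_def by blast
  qed
  then have "rel_index perm_group (V N) ?B \<le> card {0..<\<bar>k\<bar>}"
    unfolding rel_index_def by (rule surj_card_le[rotated]) simp
  then show ?thesis unfolding conj_index_act[OF g N(1)] by simp
qed

text \<open>The first \<open>K\<close> powers of \<open>a\<close> lie in different cosets: if two of them did not, \<open>g\<close> would conjugate their
  quotient to an element that fixes the base coset, that is, to a power of \<open>a\<close>.\<close>

lemma conj_index_ge:
  assumes g: "g \<in> carrier G" and K: "K > 0"
    and dvd: "\<And>i l. g \<otimes> ap i \<otimes> inv g = ap l \<Longrightarrow> int K dvd i"
  shows "conj_index perm_group (act g) (V 1) \<ge> K"
proof -
  let ?B = "conjugate perm_group (act g) (V 1)"
  have sB: "subgroup ?B perm_group" using perm.conjugate_subgroup[OF subgroup_V] act_in_C g by simp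
  let ?f = "\<lambda>i::nat. ?B #>\<^bsub>perm_group\<^esub> act (ap (int i))"
  have "inj_on ?f {0..<K}"
  proof (rule inj_onI)
    fix i j assume ij: "i \<in> {0..<K}" "j \<in> {0..<K}" "?f i = ?f j"
    have C: "act (ap (int i)) \<in> carrier perm_group" "act (ap (int j)) \<in> carrier perm_group"
      using act_in_C a_closed by auto
    have "act (ap (int i)) \<otimes>\<^bsub>perm_group\<^esub> inv\<^bsub>perm_group\<^esub> (act (ap (int j))) \<in> ?B"
      using perm.r_coset_eq_iff[OF sB C] ij(3) by simp
    moreover have "ap (int i) \<otimes> inv (ap (int j)) = ap (int i - int j)"
      using int_pow_diff[OF a_closed] by simp
    ultimately have "act (ap (int i - int j)) \<in> ?B"
      using act_mult_perm[of "ap (int i)" "inv (ap (int j))"] act_inv_perm[of "ap (int j)"] a_closed by simp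
    then obtain v where v: "v \<in> V 1"
      "act (ap (int i - int j)) = inv\<^bsub>perm_group\<^esub> (act g) \<otimes>\<^bsub>perm_group\<^esub> v \<otimes>\<^bsub>perm_group\<^esub> act g"
      unfolding conjugate_def by blast
    let ?h = "g \<otimes> ap (int i - int j) \<otimes> inv g"
    have vC: "v \<in> C" "act g \<in> C" using v V_subset_C act_in_C g by auto
    have h_app: "act ?h H = v H"
    proof -
      have giC: "act (inv g) \<in> C" using act_in_C g by simp
      have gH: "act (inv g) H \<in> X" using perm_closed[OF act_in_C H_in_X] g by simp
      have "act ?h H = act g (act (ap (int i - int j)) (act (inv g) H))"
        using g a_closed act_app[OF H_in_X] act_app l_coset_X l_coset_mult_X H_in_X by (simp add: m_assoc)
      also have "act (ap (int i - int j)) (act (inv g) H) = act (inv g) (v (act g (act (inv g) H)))"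
        unfolding v(2) act_inv_perm[OF g, symmetric]
        by (simp only: mult_app[OF mult_perm_closed[OF giC vC(1)] vC(2) gH]
          mult_app[OF giC vC(1) perm_closed[OF vC(2) gH]])
      also have "act g (act (inv g) H) = H"
        using inv_app(2)[OF vC(2) H_in_X] act_inv_perm[OF g] by simp
      also have "act g (act (inv g) (v H)) = v H"
        using inv_app(2)[OF vC(2) perm_closed[OF vC(1) H_in_X]] act_inv_perm[OF g] by simp
      finally show ?thesis .
    qed
    moreover have "v H = H" using v(1) unfolding V1_eq_stabilizer by simp
    ultimately have "?h \<in> H" using act_fixes_H_iff[of ?h] g a_closed by simp
    then obtain l where "?h = ap l" unfolding H_eq by blast
    then have "int K dvd int i - int j" by (rule dvd)
    moreover have "\<bar>int i - int j\<bar> < int K" using ij by auto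
    ultimately have "int i - int j = 0" using dvd_imp_le_int[of "int i - int j" "int K"] by linarith
    then show "i = j" by simp
  qed
  moreover have "?f ` {0..<K} \<subseteq> rel_cosets perm_group (V 1) ?B"
    unfolding rel_cosets_def using act_pow_in_V[of 1] by auto
  moreover have "finite (rel_cosets perm_group (V 1) ?B)"
    using perm.compact_open_finite_index compact_open_V1 compact_open_conjugate act_in_C[OF g] by blast
  ultimately have "card {0..<K} \<le> rel_index perm_group (V 1) ?B"
    unfolding rel_index_def by (rule card_inj_on_le)
  then show ?thesis using conj_index_act[OF g] by simp
qed

lemma conj_index_V1_le:
  assumes g: "g \<in> carrier G" and N: "N \<noteq> 0" and e: "g \<otimes> ap N \<otimes> inv g = ap N'"
  shows "int (conj_index perm_group (act g) (V 1)) \<le> \<bar>N\<bar>"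
proof (rule conj_index_le[OF g _ N])
  show "V (1 * N) \<subseteq> conjugate perm_group (act g) (V 1)"
    using conjugate_V[OF g e] V_subset_V1[of N'] by (auto simp: conjugate_def)
qed simp

end

text \<open>Here \<open>d\<close> is the greatest common divisor of \<open>m\<close> and \<open>n\<close>. It is kept as a parameter, together with the
  cofactors, so that \<open>m\<close> and \<open>n\<close> can be rewritten to products.\<close>

locale reduced_baumslag_solitar = baumslag_solitar +
  fixes d m' n' :: int
  assumes reduced: "m = d * m'" "n = d * n'" "coprime m' n'" "d > 0"
begin

lemma reduced_nonzero: "d \<noteq> 0" "m' \<noteq> 0" "n' \<noteq> 0"
  using m_nonzero n_nonzero reduced(1,2) by auto

lemma conj_t_pow: "t [^] (k::nat) \<otimes> ap (d * m' ^ k * l) \<otimes> inv (t [^] k) = ap (d * n' ^ k * l)"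
proof (induction k arbitrary: l)
  case 0
  then show ?case using a_closed by simp
next
  case (Suc k)
  have "t \<otimes> ap (d * m' ^ Suc k * l) \<otimes> inv t = ap (d * m' ^ k * (n' * l))"
  proof -
    have "m * (m' ^ k * l) = d * m' ^ Suc k * l" "n * (m' ^ k * l) = d * m' ^ k * (n' * l)"
      by (simp_all add: reduced(1,2) mult_ac)
    then show ?thesis using conj_pow_mult[OF t_closed relator, of "m' ^ k * l"] by (simp only:)
  qed
  from conj_pow_trans[OF nat_pow_closed[OF t_closed] t_closed Suc.IH this]
  show ?case by (simp add: mult_ac)
qed

text \<open>The separation assumption reads \<open>i n'\<^sup>k = l m'\<^sup>k\<close> after division by \<open>d\<^sup>k\<close>, and \<open>m'\<close> and \<open>n'\<close> are coprime.\<close>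

lemma conj_t_pow_dvd:
  assumes "t [^] (k::nat) \<otimes> ap i \<otimes> inv (t [^] k) = ap l"
  shows "m' ^ k dvd i" "n' ^ k dvd l"
proof -
  have "d ^ k * (i * n' ^ k) = d ^ k * (l * m' ^ k)"
    using separation[OF assms] unfolding reduced(1,2) by (simp add: power_mult_distrib algebra_simps)
  then have e: "i * n' ^ k = l * m' ^ k" using reduced(4) by simp
  have "coprime (m' ^ k) (n' ^ k)" using reduced(3) by simp
  then show "m' ^ k dvd i" "n' ^ k dvd l"
    using e coprime_dvd_mult_left_iff[of "m' ^ k" "n' ^ k" i] coprime_dvd_mult_left_iff[of "n' ^ k" "m' ^ k" l]
    by (metis dvd_triv_right coprime_commute)+
qed

lemma modular_act_mult: "g \<in> carrier G \<Longrightarrow> h \<in> carrier G \<Longrightarrow>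
    perm.modular (act (g \<otimes> h)) = perm.modular (act g) * perm.modular (act h)"
  using perm.modular_mult[of "act g" "act h"] act_in_C act_mult by simp

lemma modular_act_inv: "g \<in> carrier G \<Longrightarrow> perm.modular (act (inv g)) = 1 / perm.modular (act g)"
  using perm.modular_inv[of "act g"] act_in_C act_inv_perm by simp

lemma modular_act_one: "perm.modular (act \<one>) = 1"
  using group_hom.hom_one[OF act_group_hom] perm.modular_one by simp

lemma modular_act_pow:
  assumes "g \<in> carrier G"
  shows "perm.modular (act (g [^] (k::nat))) = perm.modular (act g) ^ k"
  using assms by (induction k) (simp_all add: modular_act_one modular_act_mult)

lemma modular_V1: "v \<in> V 1 \<Longrightarrow> perm.modular v = 1"
  using perm.modular_normalizer[OF compact_open_V1, of v] V1_normalizes_V[of v 1] V_subset_C[of 1] by auto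

text \<open>Up to the constant factor \<open>d\<close>, the indices of \<open>V 1\<close> that belong to \<open>t\<^sup>k\<close> and its inverse are
  \<open>\<bar>m'\<bar>\<^sup>k\<close> and \<open>\<bar>n'\<bar>\<^sup>k\<close>. Their quotient is the \<open>k\<close>-th power of the modular function at \<open>t\<close>, so the factor
  disappears as \<open>k\<close> grows.\<close>

lemma modular_t: "perm.modular (act t) = \<bar>real_of_int m\<bar> / \<bar>real_of_int n\<bar>"
proof -
  let ?M = "perm.modular (act t)" and ?p = "\<bar>real_of_int m'\<bar>" and ?q = "\<bar>real_of_int n'\<bar>"
  have pos: "?M > 0" "?p > 0" "?q > 0"
    using perm.modular_pos act_in_C[OF t_closed] reduced_nonzero by simp_all
  have bounds: "?M ^ k * ?q ^ k \<le> d * ?p ^ k \<and> ?p ^ k \<le> d * (?M ^ k * ?q ^ k)" for k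
  proof -
    define g where "g = t [^] k"
    have g: "g \<in> carrier G" unfolding g_def using t_closed by simp
    let ?A = "conj_index perm_group (act g) (V 1)" and ?B = "conj_index perm_group (act (inv g)) (V 1)"
    have conj: "g \<otimes> ap (d * m' ^ k) \<otimes> inv g = ap (d * n' ^ k)"
      using conj_t_pow[of k 1] unfolding g_def by simp
    have "int ?A \<le> \<bar>d * m' ^ k\<bar>" by (rule conj_index_V1_le[OF g _ conj]) (use reduced reduced_nonzero in simp)
    then have "real_of_int (int ?A) \<le> real_of_int \<bar>d * m' ^ k\<bar>" by (simp only: of_int_le_iff)
    then have A1: "real ?A \<le> d * ?p ^ k" using reduced(4) by (simp add: abs_mult power_abs)
    have "int ?B \<le> \<bar>d * n' ^ k\<bar>"
      by (rule conj_index_V1_le[OF inv_closed[OF g] _ conj_pow_inv[OF g conj]]) (use reduced reduced_nonzero in simp)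
    then have "real_of_int (int ?B) \<le> real_of_int \<bar>d * n' ^ k\<bar>" by (simp only: of_int_le_iff)
    then have B1: "real ?B \<le> d * ?q ^ k" using reduced(4) by (simp add: abs_mult power_abs)
    have "nat \<bar>m' ^ k\<bar> \<le> ?A"
    proof (rule conj_index_ge[OF g])
      show "int (nat \<bar>m' ^ k\<bar>) dvd i" if "g \<otimes> ap i \<otimes> inv g = ap l" for i l
        using conj_t_pow_dvd(1)[of k i l] that unfolding g_def by simp
    qed (use reduced reduced_nonzero in simp)
    then have "real_of_int \<bar>m' ^ k\<bar> \<le> real_of_int (int ?A)" by (simp only: of_int_le_iff nat_le_iff)
    then have A2: "?p ^ k \<le> real ?A" by (simp add: power_abs)
    have "nat \<bar>n' ^ k\<bar> \<le> ?B"
    proof (rule conj_index_ge[OF inv_closed[OF g]])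
      fix i l assume "inv g \<otimes> ap i \<otimes> inv (inv g) = ap l"
      from conj_pow_inv[OF inv_closed[OF g] this] have "g \<otimes> ap l \<otimes> inv g = ap i" using g by simp
      then show "int (nat \<bar>n' ^ k\<bar>) dvd i" using conj_t_pow_dvd(2)[of k l i] unfolding g_def by simp
    qed (use reduced reduced_nonzero in simp)
    then have "real_of_int \<bar>n' ^ k\<bar> \<le> real_of_int (int ?B)" by (simp only: of_int_le_iff nat_le_iff)
    then have B2: "?q ^ k \<le> real ?B" by (simp add: power_abs)
    have AB: "real ?A = ?M ^ k * real ?B"
      using perm.conj_index_modular[OF compact_open_V1, of "act g"] act_in_C[OF g] act_inv_perm[OF g]
        modular_act_pow[OF t_closed, of k] unfolding g_def by simp
    have "?M ^ k * ?q ^ k \<le> real ?A" unfolding AB using B2 pos by (intro mult_left_mono) simp_all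
    moreover have "real ?A \<le> ?M ^ k * (d * ?q ^ k)" unfolding AB using B1 pos by (intro mult_left_mono) simp_all
    ultimately show ?thesis using A1 A2 by (simp add: algebra_simps)
  qed
  have "?M * ?q \<le> ?p"
    by (rule le_of_power_le_mult_power[of _ _ d]) (use bounds pos in \<open>simp_all add: power_mult_distrib\<close>)
  moreover have "?p \<le> ?M * ?q"
    by (rule le_of_power_le_mult_power[of _ _ d]) (use bounds pos in \<open>simp_all add: power_mult_distrib\<close>)
  ultimately have "?M = ?p / ?q" using pos by (simp add: field_simps)
  then show ?thesis using reduced(4) unfolding reduced(1,2) by (simp add: abs_mult)
qed

definition q :: real where "q = \<bar>real_of_int m\<bar> / \<bar>real_of_int n\<bar>"

lemma q_pos: "q > 0"
  unfolding q_def using m_nonzero n_nonzero by simp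

text \<open>Both sides are multiplicative in \<open>g\<close>, and they agree for \<open>a\<close>, which lies in the compact group \<open>V 1\<close>, and
  for \<open>t\<close>.\<close>

lemma modular_act_eq_ratio:
  assumes "g \<in> carrier G"
  shows "\<exists>N N' e. N \<noteq> 0 \<and> N' \<noteq> 0 \<and> g \<otimes> ap N \<otimes> inv g = ap N' \<and>
    perm.modular (act g) = \<bar>real_of_int N\<bar> / \<bar>real_of_int N'\<bar> \<and> perm.modular (act g) = q powi e"
    (is "\<exists>N N' e. ?P g N N' e")
proof -
  have inv_step: "\<exists>N N' e. ?P (inv g) N N' e" if g: "g \<in> carrier G" "?P g N N' e" for g N N' e
  proof -
    have "perm.modular (act (inv g)) = inverse (perm.modular (act g))"
      using modular_act_inv[OF g(1)] by (simp add: inverse_eq_divide)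
    then have "?P (inv g) N' N (- e)"
      using g(2) conj_pow_inv[OF g(1), of N N'] power_int_minus[of q e] by (metis inverse_divide)
    then show ?thesis by blast
  qed
  have Pa: "?P a 1 1 0"
    using conj_a[of 1] modular_V1[of "act a"] act_pow_in_V[of 1 1] a_closed by simp
  have Pt: "?P t m n 1"
    using relator modular_t m_nonzero n_nonzero by (simp add: q_def)
  have "g \<in> generate G {a, t}" using assms generated by simp
  then show ?thesis
  proof (induction rule: generate.induct)
    case one
    have "?P \<one> 1 1 0" using a_closed modular_act_one by simp
    then show ?case by blast
  next
    case (incl h)
    then show ?case using Pa Pt by blast
  next
    case (inv h)
    then show ?case using inv_step[OF a_closed Pa] inv_step[OF t_closed Pt] by blast
  next
    case (eng g h)
    have gh: "g \<in> carrier G" "h \<in> carrier G" using eng generated by simp_all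
    obtain N N' e where N: "?P g N N' e" using eng.IH(1) by blast
    obtain M M' f where M: "?P h M M' f" using eng.IH(2) by blast
    have "(g \<otimes> h) \<otimes> ap (M * N) \<otimes> inv (g \<otimes> h) = ap (N' * M')"
      using conj_pow_trans[OF gh conj_pow_mult[OF gh(1), of N N' M']] conj_pow_mult[OF gh(2), of M M' N] N M
      by (simp add: mult.commute)
    moreover have "perm.modular (act (g \<otimes> h)) = \<bar>real_of_int (M * N)\<bar> / \<bar>real_of_int (N' * M')\<bar>"
    proof -
      have "perm.modular (act g) = \<bar>real_of_int N\<bar> / \<bar>real_of_int N'\<bar>"
        "perm.modular (act h) = \<bar>real_of_int M\<bar> / \<bar>real_of_int M'\<bar>" using N M by blast+
      then show ?thesis using modular_act_mult[OF gh] by (simp add: abs_mult mult.commute)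
    qed
    moreover have "perm.modular (act (g \<otimes> h)) = q powi (e + f)"
    proof -
      have "perm.modular (act g) = q powi e" "perm.modular (act h) = q powi f" using N M by blast+
      then show ?thesis using modular_act_mult[OF gh] power_int_add[of q e f] q_pos by simp
    qed
    moreover have "M * N \<noteq> 0" "N' * M' \<noteq> 0" using N M by simp_all
    ultimately have "?P (g \<otimes> h) (M * N) (N' * M') (e + f)" by blast
    then show ?case by blast
  qed
qed

lemma modular_range: "x \<in> C \<Longrightarrow> \<exists>e. perm.modular x = q powi e"
proof -
  assume "x \<in> C"
  then obtain g v where g: "g \<in> carrier G" "v \<in> V 1" "x = act g \<otimes>\<^bsub>perm_group\<^esub> v"
    using closure_factorization by blast
  then have "perm.modular x = perm.modular (act g)"
    using perm.modular_mult[of "act g" v] modular_V1[of v] act_in_C[of g] V_subset_C[of 1] by auto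
  then show ?thesis using modular_act_eq_ratio[OF g(1)] by metis
qed

text \<open>For the part of \<open>x\<close> in \<open>G\<close> the exponents \<open>N\<close> and \<open>N'\<close> agree up to sign, and the remaining factor in the
  abelian group \<open>V 1\<close> normalizes every \<open>V N\<close>.\<close>

lemma normalizes_of_modular_one:
  assumes x: "x \<in> C" "perm.modular x = 1"
  shows "\<exists>N. N \<noteq> 0 \<and> conjugate perm_group x (V N) = V N"
proof -
  obtain g v where g: "g \<in> carrier G" "v \<in> V 1" "x = act g \<otimes>\<^bsub>perm_group\<^esub> v"
    using closure_factorization x by blast
  have C: "act g \<in> C" "v \<in> C" using g act_in_C V_subset_C by auto
  have "perm.modular (act g) = 1"
    using perm.modular_mult[of "act g" v] modular_V1[OF g(2)] C x(2) g(3) by simp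
  moreover obtain N N' where N: "N \<noteq> 0" "N' \<noteq> 0" "g \<otimes> ap N \<otimes> inv g = ap N'"
    "perm.modular (act g) = \<bar>real_of_int N\<bar> / \<bar>real_of_int N'\<bar>"
    using modular_act_eq_ratio[OF g(1)] by blast
  ultimately have "\<bar>N\<bar> = \<bar>N'\<bar>" by (simp flip: of_int_abs)
  then have "conjugate perm_group (act g) (V N) = V N"
    using conjugate_V[OF g(1) N(3)] V_abs_cong by metis
  then have "conjugate perm_group x (V N) = V N"
    unfolding g(3) using perm.conjugate_conjugate[of "V N" "act g" v] C V_subset_C V1_normalizes_V[OF g(2)] by simp
  then show ?thesis using N(1) by blast
qed

lemma scale_one_of_modular_one:
  assumes "x \<in> C" "perm.modular x = 1"
  shows "tdlc_scale perm_group perm_topology x = 1"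
  using normalizes_of_modular_one[OF assms] perm.scale_eq_one_of_normalizer[OF compact_open_V] assms(1) by auto

text \<open>The modular function takes inverse values at \<open>x\<close> and its inverse, so a single value decides about both
  scales.\<close>

lemma uniscalar_part_eq:
  assumes "P \<subseteq> C"
  shows "uniscalar_part perm_group perm_topology P = {x \<in> P. perm.modular x = 1}"
proof -
  have "tdlc_scale perm_group perm_topology x = 1 \<and>
      tdlc_scale perm_group perm_topology (inv\<^bsub>perm_group\<^esub> x) = 1 \<longleftrightarrow> perm.modular x = 1"
    if "x \<in> P" for x
  proof -
    have x: "x \<in> C" "inv\<^bsub>perm_group\<^esub> x \<in> C" using that assms inv_perm_closed by auto
    show ?thesis
      using perm.modular_eq_one_of_uniscalar[of x] perm.modular_inv[of x] scale_one_of_modular_one[OF x(1)]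
        scale_one_of_modular_one[OF x(2)] x(1) by auto
  qed
  then show ?thesis unfolding uniscalar_part_def by auto
qed

text \<open>The index of \<open>V d\<close> is at most \<open>\<bar>M\<bar>\<close>. For any compact open \<open>U\<close>, the modular function forces the index
  to be a multiple of \<open>\<bar>M\<bar>\<close>, because \<open>M\<close> and \<open>N\<close> are coprime.\<close>

lemma minimizing_V:
  assumes g: "g \<in> carrier G" and e: "g \<otimes> ap (d * M) \<otimes> inv g = ap (d * N)"
    and co: "coprime M N" and nz: "M \<noteq> 0" "N \<noteq> 0"
    and mod: "perm.modular (act g) = \<bar>real_of_int M\<bar> / \<bar>real_of_int N\<bar>"
  shows "minimizing perm_group perm_topology (act g) (V d)"
proof -
  have V: "compact_open_subgroup perm_group perm_topology (V d)" using compact_open_V reduced(4) by simp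
  have gC: "act g \<in> C" by (rule act_in_C[OF g])
  have upper: "int (conj_index perm_group (act g) (V d)) \<le> \<bar>M\<bar>"
  proof (rule conj_index_le[OF g _ nz(1)])
    show "V (d * M) \<subseteq> conjugate perm_group (act g) (V d)"
      using conjugate_V[OF g e] V_mult_subset[of d N] by (auto simp: conjugate_def)
  qed (use reduced(4) in simp)
  have lower: "\<bar>M\<bar> \<le> int (conj_index perm_group (act g) U)"
    if U: "compact_open_subgroup perm_group perm_topology U" for U
  proof -
    let ?A = "conj_index perm_group (act g) U"
    let ?B = "conj_index perm_group (inv\<^bsub>perm_group\<^esub> (act g)) U"
    have "real ?A * \<bar>real_of_int N\<bar> = \<bar>real_of_int M\<bar> * real ?B"
      using perm.conj_index_modular[OF U, of "act g"] gC mod nz by simp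
    then have "real_of_int (int ?A * \<bar>N\<bar>) = real_of_int (\<bar>M\<bar> * int ?B)" by simp
    then have "int ?A * \<bar>N\<bar> = \<bar>M\<bar> * int ?B" using of_int_eq_iff by blast
    moreover have "coprime \<bar>M\<bar> \<bar>N\<bar>" using co by simp
    ultimately have "\<bar>M\<bar> dvd int ?A" using coprime_dvd_mult_left_iff by (metis dvd_triv_left)
    moreover have "?A > 0" using perm.conj_index_pos[OF U, of "act g"] gC by simp
    ultimately show ?thesis using zdvd_imp_le by simp
  qed
  obtain U where "compact_open_subgroup perm_group perm_topology U"
    "tdlc_scale perm_group perm_topology (act g) = conj_index perm_group (act g) U"
    using perm.scale_attained by blast
  then have "conj_index perm_group (act g) (V d) = tdlc_scale perm_group perm_topology (act g)"
    using perm.scale_le[OF V, of "act g"] upper lower by fastforce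
  then show ?thesis unfolding minimizing_def using V by simp
qed

lemma minimizing_t_pow:
  "minimizing perm_group perm_topology (act (t [^] (k::nat))) (V d)"
  "minimizing perm_group perm_topology (act (inv (t [^] (k::nat)))) (V d)"
proof -
  have tk: "t [^] k \<in> carrier G" using t_closed by simp
  have e: "t [^] k \<otimes> ap (d * m' ^ k) \<otimes> inv (t [^] k) = ap (d * n' ^ k)"
    using conj_t_pow[of k 1] by simp
  have co: "coprime (m' ^ k) (n' ^ k)" using reduced(3) by simp
  have mod: "perm.modular (act (t [^] k)) = \<bar>real_of_int (m' ^ k)\<bar> / \<bar>real_of_int (n' ^ k)\<bar>"
    unfolding modular_act_pow[OF t_closed] modular_t reduced(1,2) using reduced(4)
    by (simp add: abs_mult power_divide power_abs)
  show "minimizing perm_group perm_topology (act (t [^] k)) (V d)"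
    by (rule minimizing_V[OF tk e co _ _ mod]) (use reduced reduced_nonzero in simp_all)
  show "minimizing perm_group perm_topology (act (inv (t [^] k))) (V d)"
    by (rule minimizing_V[OF inv_closed[OF tk] conj_pow_inv[OF tk e]])
      (use reduced_nonzero co mod tk in \<open>simp_all add: coprime_commute modular_act_inv\<close>)
qed

definition t_powers where "t_powers = (\<lambda>k::int. act (t [^] k)) ` UNIV"

lemma flat_t_powers: "flat_subgroup perm_group perm_topology t_powers"
proof -
  have "minimizing perm_group perm_topology (act (t [^] k)) (V d)" for k :: int
  proof (cases k rule: int_cases2)
    case (nonneg i)
    then show ?thesis using minimizing_t_pow(1)[of i] by (simp add: int_pow_int)
  next
    case (nonpos i)
    then show ?thesis using minimizing_t_pow(2)[of i] t_closed by (simp add: int_pow_neg_int)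
  qed
  moreover have "subgroup t_powers perm_group"
  proof -
    have "t_powers = act ` generate G {t}" unfolding t_powers_def generate_pow[OF t_closed] by auto
    moreover have "subgroup (generate G {t}) G" by (rule generate_is_subgroup) (simp add: t_closed)
    ultimately have "subgroup t_powers (BijGroup X)"
      using group_hom.subgroup_img_is_subgroup[OF act_group_hom] by simp
    moreover have "t_powers \<subseteq> C" unfolding t_powers_def using act_in_C t_closed by auto
    ultimately show ?thesis using group.subgroup_incl[OF group_BijGroup _ subgroup_Bij] by blast
  qed
  moreover have "compact_open_subgroup perm_group perm_topology (V d)"
    using compact_open_V reduced(4) by simp
  ultimately show ?thesis unfolding flat_subgroup_def t_powers_def by blast
qed

end

section \<open>Quotients by kernels of integer-valued homomorphisms\<close>

lemma free_abelian_of_rank_trivial: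
  fixes A :: "('a, 'b) monoid_scheme"
  assumes A: "group A" "carrier A = {\<one>\<^bsub>A\<^esub>}"
  shows "free_abelian_of_rank A r \<longleftrightarrow> r = 0"
proof
  assume "free_abelian_of_rank A r"
  then obtain S :: "'a set" where S: "A \<cong> free_Abelian_group S" "r = (if finite S then enat (card S) else \<infinity>)"
    unfolding free_abelian_of_rank_def by blast
  then obtain f where "bij_betw f (carrier A) (carrier (free_Abelian_group S))"
    unfolding is_iso_def iso_def by blast
  then have c: "carrier (free_Abelian_group S) = {f \<one>\<^bsub>A\<^esub>}" using A(2) by (simp add: bij_betw_def)
  have "S = {}"
  proof (rule ccontr)
    assume "S \<noteq> {}"
    then obtain s where "s \<in> S" by blast
    then have "frag_of s \<in> carrier (free_Abelian_group S)" "0 \<in> carrier (free_Abelian_group S)" by simp_all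
    then have "frag_of s = 0" unfolding c by (metis singletonD)
    then show False by (metis frag_of_nonzero)
  qed
  then show "r = 0" using S(2) by (simp add: zero_enat_def)
next
  assume r: "r = 0"
  have c: "carrier (free_Abelian_group ({} :: 'a set)) = {0}"
    by (auto simp: free_Abelian_group_def)
  have "(\<lambda>_. 0) \<in> iso A (free_Abelian_group ({} :: 'a set))"
    unfolding iso_def using A(2) by (auto intro!: homI simp: c bij_betw_def)
  then show "free_abelian_of_rank A r"
    unfolding free_abelian_of_rank_def is_iso_def r by (intro exI[of _ "{}"]) (auto simp: zero_enat_def)
qed

text \<open>A free abelian group on two or more generators has two generators whose images in the integers
  satisfy a nontrivial linear relation, so it does not embed into the integers.\<close>

lemma free_abelian_of_rank_integers:
  fixes A :: "('a, 'b) monoid_scheme"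
  assumes A: "group A" "A \<cong> integer_group"
  shows "free_abelian_of_rank A r \<longleftrightarrow> r = 1"
proof
  assume "free_abelian_of_rank A r"
  then obtain S :: "'a set" where S: "A \<cong> free_Abelian_group S" "r = (if finite S then enat (card S) else \<infinity>)"
    unfolding free_abelian_of_rank_def by blast
  let ?F = "free_Abelian_group S"
  have "?F \<cong> integer_group" using group.iso_sym[OF A(1) S(1)] A(2) iso_trans by blast
  then obtain h where h: "h \<in> hom ?F integer_group" "bij_betw h (carrier ?F) (carrier integer_group)"
    unfolding is_iso_def iso_def by blast
  have h0: "h 0 = 0"
    using hom_one[OF h(1)] by simp
  have inj: "x = y" if "x \<in> carrier ?F" "y \<in> carrier ?F" "h x = h y" for x y
    using h(2) that unfolding bij_betw_def inj_on_def by blast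
  have "S \<noteq> {}"
  proof
    assume "S = {}"
    then have "carrier ?F = {0}" by (auto simp: free_Abelian_group_def)
    then have "carrier integer_group = {h 0}" using h(2) by (simp add: bij_betw_def)
    then have "(1::int) = 0" by (metis UNIV_I carrier_integer_group singletonD)
    then show False by simp
  qed
  then obtain s where s: "s \<in> S" by blast
  have "s' = s" if s': "s' \<in> S" for s'
  proof (rule ccontr)
    assume ne: "s' \<noteq> s"
    have cmul: "h (frag_cmul k (frag_of u)) = k * h (frag_of u)" if "u \<in> S" for k u
      using hom_int_pow[OF h(1) _ group_free_Abelian_group group_integer_group, of "frag_of u" k] that by simp
    have "frag_cmul (h (frag_of s')) (frag_of s) = frag_cmul (h (frag_of s)) (frag_of s')"
      by (rule inj) (use s s' in \<open>simp_all add: cmul mult.commute\<close>, auto)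
    then have "poly_mapping.lookup (frag_cmul (h (frag_of s')) (frag_of s)) s
        = poly_mapping.lookup (frag_cmul (h (frag_of s)) (frag_of s')) s" by simp
    then have "h (frag_of s') = 0" using ne by simp
    then have "frag_of s' = 0" using inj[of "frag_of s'" 0] s' h0 by simp
    then show False by simp
  qed
  then have "S = {s}" using s by blast
  then show "r = 1" using S(2) by (simp add: one_enat_def)
next
  assume r: "r = 1"
  have "A \<cong> free_Abelian_group {undefined :: 'a}"
    using iso_trans[OF A(2) isomorphic_group_integer_free_Abelian_group_singleton] .
  then show "free_abelian_of_rank A r"
    unfolding free_abelian_of_rank_def r by (intro exI[of _ "{undefined}"]) (simp add: one_enat_def)
qed

text \<open>The quotient is isomorphic to the image of \<open>\<phi>\<close>, a subgroup of the integers.\<close>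

lemma free_abelian_of_rank_Mod_kernel:
  fixes \<phi> :: "'a \<Rightarrow> int"
  assumes K: "group K" and hom: "\<And>x y. x \<in> carrier K \<Longrightarrow> y \<in> carrier K \<Longrightarrow> \<phi> (x \<otimes>\<^bsub>K\<^esub> y) = \<phi> x + \<phi> y"
  shows "free_abelian_of_rank (K Mod {x \<in> carrier K. \<phi> x = 0}) r \<longleftrightarrow>
    r = (if \<forall>x\<in>carrier K. \<phi> x = 0 then 0 else 1)"
proof -
  interpret K: group K by (rule K)
  have \<phi>: "group_hom K integer_group \<phi>"
    using K hom by (auto simp: group_hom_def group_hom_axioms_def intro!: homI)
  let ?N = "{x \<in> carrier K. \<phi> x = 0}"
  have ker: "kernel K integer_group \<phi> = ?N" by (auto simp: kernel_def)
  have normal: "?N \<lhd> K" using group_hom.normal_kernel[OF \<phi>] ker by simp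
  have grp: "group (K Mod ?N)" by (rule normal.factorgroup_is_group[OF normal])
  show ?thesis
  proof (cases "\<forall>x\<in>carrier K. \<phi> x = 0")
    case True
    then have N: "?N = carrier K" by auto
    have "carrier (K Mod ?N) = {\<one>\<^bsub>K Mod ?N\<^esub>}"
      unfolding carrier_FactGroup one_FactGroup N
      using K.coset_join2[OF _ K.subgroup_self] K.one_closed by auto
    then show ?thesis using free_abelian_of_rank_trivial[OF grp] True by simp
  next
    case False
    \<comment> \<open>The image of \<open>\<phi>\<close> is generated by its least positive element \<open>e\<close>.\<close>
    define e where "e = (LEAST k. k > 0 \<and> (\<exists>x\<in>carrier K. \<phi> x = int k))"
    have inv: "\<phi> (inv\<^bsub>K\<^esub> x) = - \<phi> x" if "x \<in> carrier K" for x
      using group_hom.hom_inv[OF \<phi> that] by simp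
    have "\<exists>k. k > 0 \<and> (\<exists>x\<in>carrier K. \<phi> x = int k)"
    proof -
      obtain x where x: "x \<in> carrier K" "\<phi> x \<noteq> 0" using False by blast
      have "\<exists>y\<in>carrier K. \<phi> y = \<bar>\<phi> x\<bar>"
        using x inv[OF x(1)] by (cases "\<phi> x > 0") (auto intro: K.inv_closed)
      then show ?thesis using x by (intro exI[of _ "nat \<bar>\<phi> x\<bar>"]) simp
    qed
    from LeastI_ex[OF this] have e: "e > 0" "\<exists>x\<in>carrier K. \<phi> x = int e"
      unfolding e_def by blast+
    then obtain z where z: "z \<in> carrier K" "\<phi> z = int e" by blast
    have zpow: "\<phi> (z [^]\<^bsub>K\<^esub> k) = k * int e" for k :: int
      using group_hom.hom_int_pow[OF \<phi> z(1), of k] z(2) by simp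
    have dvd: "int e dvd \<phi> x" if x: "x \<in> carrier K" for x
    proof -
      \<comment> \<open>The remainder of \<open>\<phi> x\<close> modulo \<open>e\<close> is again a value of \<open>\<phi>\<close>, so minimality of \<open>e\<close> makes it \<open>0\<close>.\<close>
      let ?y = "x \<otimes>\<^bsub>K\<^esub> z [^]\<^bsub>K\<^esub> (- (\<phi> x div int e))"
      have "\<phi> ?y = \<phi> x mod int e"
        using hom[OF x K.int_pow_closed[OF z(1)]] zpow by (simp add: minus_div_mult_eq_mod)
      moreover have "?y \<in> carrier K" using x z by simp
      ultimately have "\<not> (nat (\<phi> x mod int e) > 0)"
        using not_less_Least[of "nat (\<phi> x mod int e)" "\<lambda>k. k > 0 \<and> (\<exists>x\<in>carrier K. \<phi> x = int k)"] e(1)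
        unfolding e_def[symmetric] by (auto simp: nat_less_iff)
      then have "\<phi> x mod int e = 0" using e(1) by (simp add: order_antisym)
      then show ?thesis by blast
    qed
    define \<psi> where "\<psi> = (\<lambda>x. \<phi> x div int e)"
    have \<psi>: "group_hom K integer_group \<psi>"
      using K hom dvd by (auto simp: \<psi>_def group_hom_def group_hom_axioms_def div_plus_div_distrib_dvd_left intro!: homI)
    have "kernel K integer_group \<psi> = ?N"
      using dvd e(1) by (auto simp: kernel_def \<psi>_def dvd_div_eq_0_iff)
    moreover have "\<psi> ` carrier K = carrier integer_group"
    proof -
      have "\<psi> (z [^]\<^bsub>K\<^esub> k) = k" for k :: int using zpow e(1) by (simp add: \<psi>_def)
      then show ?thesis using z(1) by (metis K.int_pow_closed UNIV_eq_I carrier_integer_group imageI)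
    qed
    ultimately have "K Mod ?N \<cong> integer_group" using group_hom.FactGroup_iso[OF \<psi>] by simp
    moreover have "(if \<forall>x\<in>carrier K. \<phi> x = 0 then 0 else 1) = (1 :: enat)" using False by auto
    ultimately show ?thesis using free_abelian_of_rank_integers[OF grp, of r] by (simp only:)
  qed
qed

section \<open>The flat rank of the closure\<close>

context reduced_baumslag_solitar
begin

lemma q_powi_inject:
  assumes "q \<noteq> 1" "q powi e = q powi f"
  shows "e = f"
proof -
  have "q powi e \<noteq> q powi f" if "e < f" for e f
    using power_int_strict_increasing[OF that, of q] power_int_strict_decreasing[OF that, of q] assms(1) q_pos
    by (cases "q < 1") auto
  then show ?thesis using assms(2) by (metis linorder_neqE)
qed

text \<open>The exponent of \<open>q\<close> is determined by the modular function only for \<open>q \<noteq> 1\<close>. For \<open>q = 1\<close> the modular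
  function is trivial and the value \<open>0\<close> keeps the exponent additive.\<close>

definition exponent where "exponent x = (if q = 1 then 0 else SOME e. perm.modular x = q powi e)"

lemma modular_exponent: "x \<in> C \<Longrightarrow> perm.modular x = q powi exponent x"
proof -
  assume "x \<in> C"
  then have "\<exists>e. perm.modular x = q powi e" by (rule modular_range)
  then show ?thesis by (cases "q = 1") (auto simp: exponent_def intro: someI_ex)
qed

lemma exponent_mult:
  assumes "x \<in> C" "y \<in> C"
  shows "exponent (x \<otimes>\<^bsub>perm_group\<^esub> y) = exponent x + exponent y"
proof (cases "q = 1")
  case True
  then show ?thesis by (simp add: exponent_def)
next
  case False
  have "q powi exponent (x \<otimes>\<^bsub>perm_group\<^esub> y) = q powi (exponent x + exponent y)"
    using modular_exponent[OF assms(1)] modular_exponent[OF assms(2)]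
      modular_exponent[OF mult_perm_closed[OF assms]] perm.modular_mult[of x y] assms q_pos
    by (simp add: power_int_add)
  then show ?thesis by (rule q_powi_inject[OF False])
qed

lemma modular_eq_one_iff: "x \<in> C \<Longrightarrow> perm.modular x = 1 \<longleftrightarrow> exponent x = 0"
proof
  assume x: "x \<in> C" "perm.modular x = 1"
  show "exponent x = 0"
  proof (cases "q = 1")
    case False
    then show ?thesis using q_powi_inject[of "exponent x" 0] modular_exponent[OF x(1)] x(2) by simp
  qed (simp add: exponent_def)
qed (simp add: modular_exponent)

lemma subgroup_flat_rank_eq:
  assumes P: "subgroup P perm_group"
  shows "subgroup_flat_rank perm_group perm_topology P = (if \<forall>x\<in>P. perm.modular x = 1 then 0 else 1)"
proof -
  let ?K = "perm_group\<lparr>carrier := P\<rparr>"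
  have PC: "P \<subseteq> C" using subgroup.subset[OF P] by simp
  have "{x \<in> carrier ?K. exponent x = 0} = uniscalar_part perm_group perm_topology P"
    unfolding uniscalar_part_eq[OF PC] using modular_eq_one_iff PC by auto
  moreover have "(\<forall>x\<in>carrier ?K. exponent x = 0) \<longleftrightarrow> (\<forall>x\<in>P. perm.modular x = 1)"
    using modular_eq_one_iff PC by auto
  moreover have "exponent (x \<otimes>\<^bsub>?K\<^esub> y) = exponent x + exponent y"
    if "x \<in> carrier ?K" "y \<in> carrier ?K" for x y
    using exponent_mult[of x y] that PC by auto
  ultimately have "free_abelian_of_rank (?K Mod uniscalar_part perm_group perm_topology P) r \<longleftrightarrow>
      r = (if \<forall>x\<in>P. perm.modular x = 1 then 0 else 1)" for r
    using free_abelian_of_rank_Mod_kernel[of ?K exponent r] perm.subgroup_imp_group[OF P] by simp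
  then show ?thesis unfolding subgroup_flat_rank_def by (intro the_equality) simp_all
qed

theorem flat_rank_closure:
  "flat_rank perm_group perm_topology = (if \<bar>m\<bar> \<noteq> \<bar>n\<bar> then 1 else 0)"
proof -
  have q: "q = 1 \<longleftrightarrow> \<bar>m\<bar> = \<bar>n\<bar>"
    unfolding q_def using n_nonzero by (auto simp flip: of_int_abs)
  have sub: "subgroup P perm_group" if "flat_subgroup perm_group perm_topology P" for P
    using that by (simp add: flat_subgroup_def)
  show ?thesis
  proof (cases "\<bar>m\<bar> = \<bar>n\<bar>")
    case True
    have "perm.modular x = 1" if "x \<in> C" for x
      using modular_exponent[OF that] True q by simp
    then have "subgroup_flat_rank perm_group perm_topology P = 0"
      if "flat_subgroup perm_group perm_topology P" for P
      using subgroup_flat_rank_eq[OF sub[OF that]] subgroup.subset[OF sub[OF that]] by auto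
    then have "flat_rank perm_group perm_topology \<le> 0"
      unfolding flat_rank_def by (intro SUP_least) simp
    then show ?thesis using True by simp
  next
    case False
    have "flat_rank perm_group perm_topology \<le> 1"
      unfolding flat_rank_def by (intro SUP_least) (use sub subgroup_flat_rank_eq in simp)
    moreover have "1 \<le> flat_rank perm_group perm_topology"
    proof -
      have "act t \<in> t_powers" unfolding t_powers_def using t_closed by (intro image_eqI[of _ _ 1]) simp_all
      moreover have "perm.modular (act t) \<noteq> 1"
        using modular_t False q unfolding q_def by simp
      ultimately have "subgroup_flat_rank perm_group perm_topology t_powers = 1"
        using subgroup_flat_rank_eq[OF sub[OF flat_t_powers]] by auto
      then show ?thesis unfolding flat_rank_def using flat_t_powers by (intro SUP_upper2[of t_powers]) simp_all
    qed
    ultimately show ?thesis using False by simp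
  qed
qed

end

section \<open>Baumslag--Solitar groups given by their presentation\<close>

lemma word_class_eq_iff: "word_class R u = word_class R v \<longleftrightarrow> word_eq R u v"
proof
  assume "word_class R u = word_class R v"
  then have "v \<in> word_class R u" by (simp add: word_class_def word_eq.refl)
  then show "word_eq R u v" by (simp add: word_class_def)
next
  assume "word_eq R u v"
  then show "word_class R u = word_class R v"
    unfolding word_class_def by (auto intro: word_eq.trans word_eq.sym)
qed

lemma carrier_presented_group: "carrier (presented_group R) = range (word_class R)"
  by (simp add: presented_group_def)

lemma one_presented_group: "\<one>\<^bsub>presented_group R\<^esub> = word_class R []"
  by (simp add: presented_group_def)

lemma mult_presented_group:
  "word_class R u \<otimes>\<^bsub>presented_group R\<^esub> word_class R v = word_class R (u @ v)"
proof -
  have "word_eq R (u' @ v') w \<Longrightarrow> word_eq R u u' \<Longrightarrow> word_eq R v v' \<Longrightarrow> word_eq R (u @ v) w" for u' v' w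
    by (blast intro: word_eq.trans word_eq.append)
  then show ?thesis
    unfolding presented_group_def word_class_def by (auto intro: word_eq.refl)
qed

definition word_inverse :: "'g word \<Rightarrow> 'g word" where
  "word_inverse u = rev (map (\<lambda>(x, b). (x, \<not> b)) u)"

text \<open>Adjacent inverse letters in the middle cancel first, which leaves the same claim for a shorter
  word.\<close>

lemma word_eq_inverse: "word_eq R (word_inverse u @ u) []"
proof (induction u)
  case Nil
  show ?case by (simp add: word_inverse_def word_eq.refl)
next
  case (Cons l u)
  obtain x b where l: "l = (x, b)" by (cases l)
  have "word_eq R [(x, \<not> b), (x, b)] []" using word_eq.cancel[of R x "\<not> b"] by simp
  then have "word_eq R (word_inverse u @ ([(x, \<not> b), (x, b)] @ u)) (word_inverse u @ ([] @ u))"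
    by (intro word_eq.append word_eq.refl)
  then show ?case using Cons.IH word_eq.trans by (fastforce simp: word_inverse_def l)
qed

lemma group_presented_group: "group (presented_group R)"
proof (rule groupI)
  fix x assume "x \<in> carrier (presented_group R)"
  then obtain u where "x = word_class R u" by (auto simp: carrier_presented_group)
  then have "word_class R (word_inverse u) \<otimes>\<^bsub>presented_group R\<^esub> x = \<one>\<^bsub>presented_group R\<^esub>"
    by (simp add: mult_presented_group one_presented_group word_class_eq_iff word_eq_inverse)
  then show "\<exists>y\<in>carrier (presented_group R). y \<otimes>\<^bsub>presented_group R\<^esub> x = \<one>\<^bsub>presented_group R\<^esub>"
    by (auto simp: carrier_presented_group)
qed (auto simp: carrier_presented_group one_presented_group mult_presented_group)

lemma inv_presented_group_generator:
  "inv\<^bsub>presented_group R\<^esub> (word_class R [(x, b)]) = word_class R [(x, \<not> b)]"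
proof (rule group.inv_equality[OF group_presented_group])
  show "word_class R [(x, \<not> b)] \<otimes>\<^bsub>presented_group R\<^esub> word_class R [(x, b)] = \<one>\<^bsub>presented_group R\<^esub>"
    using word_eq.cancel[of R x "\<not> b"]
    by (simp add: mult_presented_group one_presented_group word_class_eq_iff)
qed (auto simp: carrier_presented_group)

lemma word_class_replicate:
  "word_class R (replicate k (x, b)) = word_class R [(x, b)] [^]\<^bsub>presented_group R\<^esub> k"
proof (induction k)
  case 0
  interpret group "presented_group R" by (rule group_presented_group)
  show ?case by (simp add: one_presented_group)
next
  case (Suc k)
  interpret group "presented_group R" by (rule group_presented_group)
  show ?case
    unfolding replicate_Suc replicate_append_same[symmetric] nat_pow_Suc Suc.IH[symmetric]
      mult_presented_group ..
qed

lemma word_class_gen_power: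
  "word_class R (gen_power x k) = word_class R [(x, True)] [^]\<^bsub>presented_group R\<^esub> (k :: int)"
proof -
  interpret group "presented_group R" by (rule group_presented_group)
  have x: "word_class R [(x, True)] \<in> carrier (presented_group R)" by (simp add: carrier_presented_group)
  show ?thesis
  proof (cases "0 \<le> k")
    case True
    then obtain j where k: "k = int j" by (rule nonneg_int_cases)
    then have "gen_power x k = replicate j (x, True)" by (simp add: gen_power_def)
    then show ?thesis unfolding k by (simp only: word_class_replicate int_pow_int)
  next
    case False
    then obtain j where k: "k = - int j" "j > 0" by (metis neg_int_cases not_le)
    then have "gen_power x k = replicate j (x, False)" by (simp add: gen_power_def)
    moreover have "word_class R [(x, False)] = inv\<^bsub>presented_group R\<^esub> (word_class R [(x, True)])"
      by (simp only: inv_presented_group_generator simp_thms)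
    ultimately show ?thesis
      unfolding k by (simp only: word_class_replicate int_pow_neg_int[OF x] nat_pow_inv[OF x])
  qed
qed

lemma presented_group_generated:
  "carrier (presented_group R) = generate (presented_group R) (range (\<lambda>x. word_class R [(x, True)]))"
    (is "_ = generate _ ?S")
proof
  interpret group "presented_group R" by (rule group_presented_group)
  have "word_class R u \<in> generate (presented_group R) ?S" for u
  proof (induction u)
    case Nil
    show ?case using generate.one[of "presented_group R" ?S] by (simp add: one_presented_group)
  next
    case (Cons l u)
    obtain x b where l: "l = (x, b)" by (cases l)
    have "word_class R [(x, True)] \<in> generate (presented_group R) ?S" by (rule generate.incl) blast
    moreover have "word_class R [(x, False)] \<in> generate (presented_group R) ?S"
      using generate.inv[of "word_class R [(x, True)]" ?S "presented_group R"]
      by (simp add: inv_presented_group_generator)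
    ultimately have "word_class R [l] \<in> generate (presented_group R) ?S" unfolding l by (cases b) simp_all
    from generate.eng[OF this Cons.IH] show ?case by (simp add: mult_presented_group)
  qed
  then show "carrier (presented_group R) \<subseteq> generate (presented_group R) ?S"
    by (auto simp: carrier_presented_group)
  show "generate (presented_group R) ?S \<subseteq> carrier (presented_group R)"
    by (rule generate_incl) (auto simp: carrier_presented_group)
qed

text \<open>The action of \<open>BS(m,n)\<close> on the rational line by the maps \<open>y \<mapsto> y + 1\<close> and \<open>y \<mapsto> (n / m) y\<close>.\<close>

fun affine_letter :: "int \<Rightarrow> int \<Rightarrow> bs_gen \<times> bool \<Rightarrow> rat \<Rightarrow> rat" where
  "affine_letter m n (GenA, True) y = y + 1"
| "affine_letter m n (GenA, False) y = y - 1"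
| "affine_letter m n (GenT, True) y = of_int n / of_int m * y"
| "affine_letter m n (GenT, False) y = of_int m / of_int n * y"

definition affine_word :: "int \<Rightarrow> int \<Rightarrow> bs_gen word \<Rightarrow> rat \<Rightarrow> rat" where
  "affine_word m n w = foldr (affine_letter m n) w"

lemma affine_word_append: "affine_word m n (u @ v) y = affine_word m n u (affine_word m n v y)"
  by (simp add: affine_word_def)

lemma affine_word_gen_power:
  assumes "m \<noteq> 0" "n \<noteq> 0"
  shows "affine_word m n (gen_power GenA k) y = y + of_int k"
    and "affine_word m n (gen_power GenT k) y = (of_int n / of_int m) powi k * y"
proof -
  have A: "affine_word m n (replicate j (GenA, True)) y = y + of_nat j"
    "affine_word m n (replicate j (GenA, False)) y = y - of_nat j"
    "affine_word m n (replicate j (GenT, True)) y = (of_int n / of_int m) ^ j * y"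
    "affine_word m n (replicate j (GenT, False)) y = (of_int m / of_int n) ^ j * y" for j
    by (induction j) (simp_all add: affine_word_def)
  show "affine_word m n (gen_power GenA k) y = y + of_int k"
    by (cases "0 \<le> k") (simp_all add: gen_power_def A)
  show "affine_word m n (gen_power GenT k) y = (of_int n / of_int m) powi k * y"
    by (cases "0 \<le> k") (simp_all add: gen_power_def A power_int_def power_inverse[symmetric])
qed

text \<open>The affine maps satisfy the defining relation: \<open>t a\<^sup>m t\<inverse>\<close> translates by \<open>(n / m) m = n\<close>.\<close>

lemma affine_word_cong:
  assumes "m \<noteq> 0" "n \<noteq> 0" and "word_eq (BS_rels m n) u v"
  shows "affine_word m n u y = affine_word m n v y"
  using assms(3)
proof (induction arbitrary: y)
  case (append u u' v v')
  then show ?case by (simp add: affine_word_append)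
next
  case (cancel x b)
  then show ?case using assms(1,2) by (cases x; cases b) (simp_all add: affine_word_def)
next
  case (relation u v)
  then show ?case
    using assms(1,2) by (simp add: BS_rels_def affine_word_append affine_word_gen_power field_simps)
qed simp_all

text \<open>The lower bound on conjugation follows by letting both sides of \<open>t\<^sup>k a\<^sup>i t\<^sup>-\<^sup>k = a\<^sup>l\<close> act on the rational
  number \<open>0\<close>, which gives \<open>(n / m)\<^sup>k i = l\<close>.\<close>

lemma baumslag_solitar_BS:
  assumes "m \<noteq> 0" "n \<noteq> 0"
  shows "baumslag_solitar (BS m n) (BS_a m n) (word_class (BS_rels m n) [(GenT, True)]) m n"
proof -
  let ?R = "BS_rels m n"
  let ?t = "word_class ?R [(GenT, True)]"
  interpret group "BS m n" unfolding BS_def by (rule group_presented_group)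
  have t: "?t \<in> carrier (BS m n)" and a: "BS_a m n \<in> carrier (BS m n)"
    by (auto simp: BS_def BS_a_def carrier_presented_group)
  have conj: "?t [^]\<^bsub>BS m n\<^esub> k \<otimes>\<^bsub>BS m n\<^esub> BS_a m n [^]\<^bsub>BS m n\<^esub> i \<otimes>\<^bsub>BS m n\<^esub> inv\<^bsub>BS m n\<^esub> (?t [^]\<^bsub>BS m n\<^esub> k)
      = word_class ?R (gen_power GenT (int k) @ gen_power GenA i @ gen_power GenT (- int k))"
    for k :: nat and i :: int
  proof -
    have "inv\<^bsub>BS m n\<^esub> (?t [^]\<^bsub>BS m n\<^esub> k) = word_class ?R (gen_power GenT (- int k))"
      using int_pow_neg_int[OF t, of k] by (simp add: BS_def word_class_gen_power)
    moreover have "?t [^]\<^bsub>BS m n\<^esub> k = word_class ?R (gen_power GenT (int k))"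
      by (simp add: BS_def word_class_gen_power int_pow_int)
    moreover have "BS_a m n [^]\<^bsub>BS m n\<^esub> i = word_class ?R (gen_power GenA i)"
      by (simp add: BS_def BS_a_def word_class_gen_power)
    ultimately show ?thesis by (simp add: BS_def mult_presented_group)
  qed
  have pow_a: "BS_a m n [^]\<^bsub>BS m n\<^esub> i = word_class ?R (gen_power GenA i)" for i :: int
    by (simp add: BS_def BS_a_def word_class_gen_power)
  show ?thesis
  proof
    show "BS_a m n \<in> carrier (BS m n)" "?t \<in> carrier (BS m n)" by (fact a t)+
    have "range (\<lambda>x. word_class ?R [(x, True)]) = {BS_a m n, ?t}"
    proof -
      have "UNIV = {GenA, GenT}" using bs_gen.exhaust by blast
      show ?thesis unfolding BS_a_def \<open>UNIV = {GenA, GenT}\<close> by simp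
    qed
    then show "carrier (BS m n) = generate (BS m n) {BS_a m n, ?t}"
      unfolding BS_def using presented_group_generated[of ?R] by simp
    show "m \<noteq> 0" "n \<noteq> 0" by (fact assms)+
    have "word_eq ?R (gen_power GenT 1 @ gen_power GenA m @ gen_power GenT (- 1)) (gen_power GenA n)"
      by (rule word_eq.relation) (simp add: BS_rels_def)
    then show "?t \<otimes>\<^bsub>BS m n\<^esub> BS_a m n [^]\<^bsub>BS m n\<^esub> m \<otimes>\<^bsub>BS m n\<^esub> inv\<^bsub>BS m n\<^esub> ?t = BS_a m n [^]\<^bsub>BS m n\<^esub> n"
      using conj[of 1 m] t pow_a[of n] by (simp add: word_class_eq_iff)
    fix k :: nat and i l :: int
    assume "?t [^]\<^bsub>BS m n\<^esub> k \<otimes>\<^bsub>BS m n\<^esub> BS_a m n [^]\<^bsub>BS m n\<^esub> i \<otimes>\<^bsub>BS m n\<^esub> inv\<^bsub>BS m n\<^esub> (?t [^]\<^bsub>BS m n\<^esub> k)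
      = BS_a m n [^]\<^bsub>BS m n\<^esub> l"
    then have "word_eq ?R (gen_power GenT (int k) @ gen_power GenA i @ gen_power GenT (- int k)) (gen_power GenA l)"
      by (simp only: conj) (simp only: pow_a word_class_eq_iff)
    from affine_word_cong[OF assms this, of 0]
    have "(of_int n / of_int m) ^ k * of_int i = (of_int l :: rat)"
      by (simp add: affine_word_append affine_word_gen_power[OF assms])
    then have "(of_int (i * n ^ k) :: rat) = of_int (l * m ^ k)"
      using assms by (simp add: power_divide field_simps)
    then show "i * n ^ k = l * m ^ k" by (simp only: of_int_eq_iff)
  qed
qed

theorem proposition7p4:
  fixes m n :: int
  assumes "m \<noteq> 0" and "n \<noteq> 0"
  shows "flat_rank (G_group m n) (G_topology m n) = (if \<bar>m\<bar> \<noteq> \<bar>n\<bar> then 1 else 0)"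
proof -
  interpret reduced_baumslag_solitar "BS m n" "BS_a m n" "word_class (BS_rels m n) [(GenT, True)]" m n
    "gcd m n" "m div gcd m n" "n div gcd m n"
    using baumslag_solitar_BS[OF assms] assms
    by (simp add: reduced_baumslag_solitar_def reduced_baumslag_solitar_axioms_def div_gcd_coprime)
  have "act ` carrier (BS m n) \<subseteq> Bij X" using act_Bij by blast
  then have C: "BS_closure m n = C"
    unfolding BS_closure_def C_def X_def act_def by (rule closure_of_pointwise_topology)
  have "G_group m n = perm_group" "G_topology m n = perm_topology"
    unfolding G_group_def G_topology_def C X_def by simp_all
  then show ?thesis using flat_rank_closure by simp
qed

end
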